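(* Let $R$ be a commutative ring, $F$ a free $R$-module of rank $n\ge 1$ with basis $f_1,\dots,f_n$, and $\psi:F\to R$ an $R$-linear map such that $\operatorname{grade}(\operatorname{im}\psi)=n$ and $\psi(f_1),\dots,\psi(f_n)$ is a regular sequence. Assume either that $R$ is a Noetherian local ring, or that $R$ is a $\mathbb{Z}$-graded ring and $\psi(f_1),\dots,\psi(f_n)$ are homogeneous of positive degree. Let $w=(w_1,\dots,w_n)\in\mathbb{Z}_{\ge 0}^n$ and let $d\ge 1$ be an integer. Then the complex $L^w(\psi,d)$, $$0 \to L_{d,w}^{n-1} \xrightarrow{\mathrm{Kos}\otimes 1} \cdots \xrightarrow{\mathrm{Kos}\otimes 1} L_{d,w}^{1} \xrightarrow{\mathrm{Kos}\otimes 1} (S_d)_w \xrightarrow{\psi} R \to 0,$$ is the minimal free resolution of $R/(\operatorname{im}\psi)^d_w$.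
   Context: For $\alpha,\beta\in\mathbb{Z}^n$ write $\alpha\le\beta$ if $\alpha_i\le\beta_i$ for all $i$, and $|\alpha|=\alpha_1+\cdots+\alpha_n$; $\epsilon_i$ is the $i$th standard unit vector. Restricted power: $(\operatorname{im}\psi)^d_w$ is the ideal of $R$ generated by all products $\psi(f_1)^{\alpha_1}\cdots\psi(f_n)^{\alpha_n}$ with $\alpha\in\mathbb{Z}_{\ge0}^n$, $\alpha\le w$ and $|\alpha|=d$. Notation: $\bigwedge^a=\bigwedge^a F$ and $S_b=S_b(F)$ are exterior and symmetric powers. For $\sigma=(\sigma_1<\cdots<\sigma_a)\subseteq\{1,\dots,n\}$ and $\alpha\in\mathbb{Z}_{\ge 0}^n$ with $|\alpha|=b$, put $f_\sigma=f_{\sigma_1}\wedge\cdots\wedge f_{\sigma_a}\in\bigwedge^a$ and $f^\alpha=f_1^{\alpha_1}\cdots f_n^{\alpha_n}\in S_b$. The multidegree of $f_\sigma\otimes f^\alpha\in\bigwedge^a\otimes S_b$ is $\epsilon_{\sigma_1}+\cdots+\epsilon_{\sigma_a}+\alpha$. $(\bigwedge^a\otimes S_b)_w$ is the free $R$-submodule of $\bigwedge^a\otimes S_b$ spanned by all $f_\sigma\otimes f^\alpha$ of multidegree $\le w$; $(S_d)_w=(\bigwedge^0\otimes S_d)_w$. The tautological Koszul map $\kappa:(\bigwedge^a\otimes S_b)_w\to(\bigwedge^{a-1}\otimes S_{b+1})_w$ is $\kappa(f_\sigma\otimes f^\alpha)=\sum_{j=1}^a(-1)^{j-1}f_{\sigma\setminus\sigma_j}\otimes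 f_{\sigma_j}f^\alpha$ (it preserves multidegree; $\kappa=0$ on $\bigwedge^0\otimes S_b$). Define $L^a_{b,w}:=\ker\big(\kappa:(\bigwedge^a\otimes S_b)_w\to(\bigwedge^{a-1}\otimes S_{b+1})_w\big)$; in particular $L^0_{d,w}=(S_d)_w$. $\mathrm{Kos}:\bigwedge^a\to\bigwedge^{a-1}$ is the Koszul differential induced by $\psi$, $\mathrm{Kos}(f_\sigma)=\sum_{j}(-1)^{j-1}\psi(f_{\sigma_j})f_{\sigma\setminus\sigma_j}$. The maps $\mathrm{Kos}\otimes1$ and $\kappa$ anticommute, so $\mathrm{Kos}\otimes 1$ maps $L^a_{d,w}$ to $L^{a-1}_{d,w}$. The map $\psi:(S_d)_w\to R$ sends $f^\alpha$ to $\psi(f_1)^{\alpha_1}\cdots\psi(f_n)^{\alpha_n}$. In $L^w(\psi,d)$, $R$ sits in homological degree $0$ and $L^{i-1}_{d,w}$ in homological degree $i\ge 1$. Minimal means that the entries of the differentials lie in the maximal ideal of $R$ (local case), respectively in the ideal generated by homogeneous elements of positive degree (graded case).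
   Formalization: In the graded case the formal theorem also assumes that the grading is bounded below or that ψ(f_1),…,ψ(f_n) is regular in every order; for arbitrary ℤ-gradings the claim fails, e.g. k[X,Y]×k[T,1/T] with (X,T),(Y,0), d=1, w=(0,1). *)

theory Defs
  imports "HOL-Library.Poly_Mapping" "HOL-Library.Extended_Nat" "HOL-Library.Multiset" Complex_Main
begin

section \<open>Ideals, regular sequences, grade\<close>

text \<open>A ring is a type of class \<^class>\<open>comm_ring_1\<close>; it is a module over itself via
  multiplication, and its ideals are the submodules.\<close>

lemma module_ring_self: "module ((*) :: 'r::comm_ring_1 \<Rightarrow> 'r \<Rightarrow> 'r)"
  by unfold_locales (simp_all add: algebra_simps)

abbreviation is_ideal :: "'r::comm_ring_1 set \<Rightarrow> bool" where
  "is_ideal \<equiv> module.subspace (*)"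

abbreviation ideal_gen :: "'r::comm_ring_1 set \<Rightarrow> 'r set" where
  "ideal_gen \<equiv> module.span (*)"

definition maximal_ideal :: "'r::comm_ring_1 set \<Rightarrow> bool" where
  "maximal_ideal M \<longleftrightarrow> is_ideal M \<and> M \<noteq> UNIV \<and>
     (\<forall>I. is_ideal I \<longrightarrow> M \<subseteq> I \<longrightarrow> I = M \<or> I = UNIV)"

definition noetherian :: "'r::comm_ring_1 itself \<Rightarrow> bool" where
  "noetherian _ \<longleftrightarrow> (\<forall>I :: 'r set. is_ideal I \<longrightarrow> (\<exists>S. finite S \<and> I = ideal_gen S))"

definition local_with_maximal_ideal :: "'r::comm_ring_1 set \<Rightarrow> bool" where
  "local_with_maximal_ideal M \<longleftrightarrow> maximal_ideal M \<and> (\<forall>M'. maximal_ideal M' \<longrightarrow> M' = M)"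

definition regular_sequence :: "'r::comm_ring_1 list \<Rightarrow> bool" where
  "regular_sequence xs \<longleftrightarrow>
     (\<forall>i<length xs. \<forall>r. xs ! i * r \<in> ideal_gen (set (take i xs)) \<longrightarrow>
                       r \<in> ideal_gen (set (take i xs))) \<and>
     ideal_gen (set xs) \<noteq> UNIV"

definition grade :: "'r::comm_ring_1 set \<Rightarrow> enat" where
  "grade I = Sup {enat (length xs) | xs. set xs \<subseteq> I \<and> regular_sequence xs}"


section \<open>Gradings\<close>

definition int_grading :: "(int \<Rightarrow> 'r::comm_ring_1 set) \<Rightarrow> bool" where
  "int_grading G \<longleftrightarrow>
     (\<forall>i. 0 \<in> G i \<and> (\<forall>a\<in>G i. \<forall>b\<in>G i. a - b \<in> G i)) \<and>
     (\<forall>i j. \<forall>a\<in>G i. \<forall>b\<in>G j. a * b \<in> G (i + j)) \<and>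
     (\<forall>r. \<exists>!c :: int \<Rightarrow>\<^sub>0 'r. (\<forall>k. Poly_Mapping.lookup c k \<in> G k) \<and>
            r = (\<Sum>k\<in>Poly_Mapping.keys c. Poly_Mapping.lookup c k))"

definition positive_ideal :: "(int \<Rightarrow> 'r::comm_ring_1 set) \<Rightarrow> 'r set" where
  "positive_ideal G = ideal_gen (\<Union>k\<in>{0<..}. G k)"

definition bounded_below :: "(int \<Rightarrow> 'r::comm_ring_1 set) \<Rightarrow> bool" where
  "bounded_below G \<longleftrightarrow> (\<exists>N. \<forall>k<N. G k = {0})"

text \<open>Over a Noetherian local ring, or for homogeneous elements of positive degree in a graded
  ring whose grading is bounded below, every rearrangement of a regular sequence is regular.
  For a general \<open>\<int>\<close>-grading this fails: in \<open>k[X,Y] \<times> k[T,1/T]\<close> with \<open>deg X = deg Y = deg T = 1\<close>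
  the sequence \<open>(X,T), (Y,0)\<close> is regular, but \<open>(Y,0)\<close> is a zero divisor.\<close>

definition permutably_regular :: "'r::comm_ring_1 list \<Rightarrow> bool" where
  "permutably_regular xs \<longleftrightarrow> (\<forall>ys. mset ys = mset xs \<longrightarrow> regular_sequence ys)"


section \<open>Free modules and minimal free resolutions\<close>

definition basis_of :: "('r::comm_ring_1 \<Rightarrow> 'm::ab_group_add \<Rightarrow> 'm) \<Rightarrow> 'm set \<Rightarrow> 'm set \<Rightarrow> bool" where
  "basis_of scale B C \<longleftrightarrow> \<not> module.dependent scale B \<and> module.span scale B = C"

text \<open>A family \<open>C i\<close> of submodules of one ambient module, placed in homological degrees \<open>i \<ge> 1\<close>,
  with maps \<open>D i : C i \<rightarrow> C (i - 1)\<close> for \<open>i \<ge> 2\<close> and \<open>e : C 1 \<rightarrow> R\<close>, the ring itself being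
  the term in degree 0 (\<open>C 0\<close>, \<open>D 0\<close>, \<open>D 1\<close> play no role). It resolves \<open>R/I\<close>, augmented by the
  projection \<open>R \<rightarrow> R/I\<close>: exactness in degree 0 says that the image of \<open>e\<close> is \<open>I\<close>.\<close>

definition free_resolution_of_quotient ::
  "('r::comm_ring_1 \<Rightarrow> 'm::ab_group_add \<Rightarrow> 'm) \<Rightarrow> (nat \<Rightarrow> 'm set) \<Rightarrow> (nat \<Rightarrow> 'm \<Rightarrow> 'm) \<Rightarrow>
   ('m \<Rightarrow> 'r) \<Rightarrow> 'r set \<Rightarrow> bool" where
  "free_resolution_of_quotient scale C D e I \<longleftrightarrow>
     (\<forall>i\<ge>1. \<exists>B. basis_of scale B (C i)) \<and>
     module_hom scale (*) e \<and>
     (\<forall>i\<ge>2. module_hom scale scale (D i) \<and> D i ` C i \<subseteq> C (i - 1)) \<and>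
     e ` C 1 = I \<and>
     {x \<in> C 1. e x = 0} = D 2 ` C 2 \<and>
     (\<forall>i\<ge>2. {x \<in> C i. D i x = 0} = D (Suc i) ` C (Suc i))"

text \<open>All matrix entries of the differentials, with respect to any bases, lie in \<open>J\<close>;
  the degree 0 term \<open>R\<close> has the basis 1.\<close>

definition minimal_complex ::
  "('r::comm_ring_1 \<Rightarrow> 'm::ab_group_add \<Rightarrow> 'm) \<Rightarrow> (nat \<Rightarrow> 'm set) \<Rightarrow> (nat \<Rightarrow> 'm \<Rightarrow> 'm) \<Rightarrow>
   ('m \<Rightarrow> 'r) \<Rightarrow> 'r set \<Rightarrow> bool" where
  "minimal_complex scale C D e J \<longleftrightarrow>
     (\<forall>A. basis_of scale A (C 1) \<longrightarrow> (\<forall>a\<in>A. e a \<in> J)) \<and>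
     (\<forall>i\<ge>2. \<forall>A B. basis_of scale A (C i) \<longrightarrow> basis_of scale B (C (i - 1)) \<longrightarrow>
        (\<forall>a\<in>A. \<forall>b\<in>B. module.representation scale B (D i a) b \<in> J))"

definition minimal_free_resolution_of_quotient ::
  "('r::comm_ring_1 \<Rightarrow> 'm::ab_group_add \<Rightarrow> 'm) \<Rightarrow> (nat \<Rightarrow> 'm set) \<Rightarrow> (nat \<Rightarrow> 'm \<Rightarrow> 'm) \<Rightarrow>
   ('m \<Rightarrow> 'r) \<Rightarrow> 'r set \<Rightarrow> 'r set \<Rightarrow> bool" where
  "minimal_free_resolution_of_quotient scale C D e I J \<longleftrightarrow>
     free_resolution_of_quotient scale C D e I \<and> minimal_complex scale C D e J"


section \<open>Exterior tensor symmetric powers\<close>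

text \<open>For \<open>F\<close> free on \<open>f 1, \<dots>, f n\<close>, the sum of all \<open>\<Lambda>\<^sup>a F \<otimes> S\<^sub>b F\<close> is realised inside the free
  module on pairs \<open>(\<sigma>, \<alpha>)\<close>, where \<open>(\<sigma>, \<alpha>)\<close> stands for \<open>f\<^sub>\<sigma> \<otimes> f\<^sup>\<alpha>\<close>, with the elements of
  \<open>\<sigma> \<subseteq> {1..n}\<close> taken in increasing order.\<close>

type_synonym ext_sym_index = "nat set \<times> (nat \<Rightarrow>\<^sub>0 nat)"

definition fscale :: "'r::comm_ring_1 \<Rightarrow> ('k \<Rightarrow>\<^sub>0 'r) \<Rightarrow> ('k \<Rightarrow>\<^sub>0 'r)" where
  "fscale c p = Poly_Mapping.map ((*) c) p"

lemma lookup_fscale: "Poly_Mapping.lookup (fscale c p) k = c * Poly_Mapping.lookup p k"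
  by (simp add: fscale_def Poly_Mapping.map.rep_eq when_def)

lemma module_fscale: "module (fscale :: 'r::comm_ring_1 \<Rightarrow> ('k \<Rightarrow>\<^sub>0 'r) \<Rightarrow> ('k \<Rightarrow>\<^sub>0 'r))"
  by unfold_locales
    (auto intro!: poly_mapping_eqI simp: lookup_fscale lookup_add algebra_simps)

definition linear_extension ::
  "('r::comm_ring_1 \<Rightarrow> 'm::ab_group_add \<Rightarrow> 'm) \<Rightarrow> ('k \<Rightarrow> 'm) \<Rightarrow> ('k \<Rightarrow>\<^sub>0 'r) \<Rightarrow> 'm" where
  "linear_extension scale g p =
     (\<Sum>k\<in>Poly_Mapping.keys p. scale (Poly_Mapping.lookup p k) (g k))"

definition multidegree :: "ext_sym_index \<Rightarrow> nat \<Rightarrow> nat" where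
  "multidegree = (\<lambda>(\<sigma>, \<alpha>) i. (if i \<in> \<sigma> then 1 else 0) + Poly_Mapping.lookup \<alpha> i)"

definition ext_sym_indices :: "nat \<Rightarrow> nat \<Rightarrow> nat \<Rightarrow> (nat \<Rightarrow> nat) \<Rightarrow> ext_sym_index set" where
  "ext_sym_indices n a b w =
     {(\<sigma>, \<alpha>). \<sigma> \<subseteq> {1..n} \<and> card \<sigma> = a \<and>
        Poly_Mapping.keys \<alpha> \<subseteq> {1..n} \<and> (\<Sum>i=1..n. Poly_Mapping.lookup \<alpha> i) = b \<and>
        (\<forall>i\<in>{1..n}. multidegree (\<sigma>, \<alpha>) i \<le> w i)}"

definition ext_sym_restricted ::
  "nat \<Rightarrow> nat \<Rightarrow> nat \<Rightarrow> (nat \<Rightarrow> nat) \<Rightarrow> (ext_sym_index \<Rightarrow>\<^sub>0 'r::comm_ring_1) set" where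
  "ext_sym_restricted n a b w =
     module.span fscale ((\<lambda>k. Poly_Mapping.single k 1) ` ext_sym_indices n a b w)"

text \<open>If \<open>s\<close> is the \<open>j\<close>-th element of \<open>\<sigma>\<close>, then \<open>card {t \<in> \<sigma>. t < s} = j - 1\<close>.\<close>

definition position_sign :: "nat set \<Rightarrow> nat \<Rightarrow> 'r::comm_ring_1" where
  "position_sign \<sigma> s = (- 1) ^ card {t \<in> \<sigma>. t < s}"

definition kappa :: "(ext_sym_index \<Rightarrow>\<^sub>0 'r::comm_ring_1) \<Rightarrow> (ext_sym_index \<Rightarrow>\<^sub>0 'r)" where
  "kappa = linear_extension fscale (\<lambda>(\<sigma>, \<alpha>). \<Sum>s\<in>\<sigma>.
     Poly_Mapping.single (\<sigma> - {s}, \<alpha> + Poly_Mapping.single s 1) (position_sign \<sigma> s))"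

text \<open>\<open>Kos \<otimes> 1\<close> and \<open>\<psi>\<close> on symmetric powers, in terms of the values \<open>x i = \<psi> (f i)\<close>.\<close>

definition Kos_tensor_1 ::
  "(nat \<Rightarrow> 'r::comm_ring_1) \<Rightarrow> (ext_sym_index \<Rightarrow>\<^sub>0 'r) \<Rightarrow> (ext_sym_index \<Rightarrow>\<^sub>0 'r)" where
  "Kos_tensor_1 x = linear_extension fscale (\<lambda>(\<sigma>, \<alpha>). \<Sum>s\<in>\<sigma>.
     Poly_Mapping.single (\<sigma> - {s}, \<alpha>) (position_sign \<sigma> s * x s))"

definition sym_eval :: "nat \<Rightarrow> (nat \<Rightarrow> 'r::comm_ring_1) \<Rightarrow> (ext_sym_index \<Rightarrow>\<^sub>0 'r) \<Rightarrow> 'r" where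
  "sym_eval n x = linear_extension (*) (\<lambda>(\<sigma>, \<alpha>). \<Prod>i=1..n. x i ^ Poly_Mapping.lookup \<alpha> i)"

definition L_module ::
  "nat \<Rightarrow> nat \<Rightarrow> nat \<Rightarrow> (nat \<Rightarrow> nat) \<Rightarrow> (ext_sym_index \<Rightarrow>\<^sub>0 'r::comm_ring_1) set" where
  "L_module n a b w = {p \<in> ext_sym_restricted n a b w. kappa p = 0}"

definition L_complex ::
  "nat \<Rightarrow> nat \<Rightarrow> (nat \<Rightarrow> nat) \<Rightarrow> nat \<Rightarrow> (ext_sym_index \<Rightarrow>\<^sub>0 'r::comm_ring_1) set" where
  "L_complex n d w i = (if 1 \<le> i \<and> i \<le> n then L_module n (i - 1) d w else {0})"

definition restricted_power ::
  "nat \<Rightarrow> (nat \<Rightarrow> 'r::comm_ring_1) \<Rightarrow> nat \<Rightarrow> (nat \<Rightarrow> nat) \<Rightarrow> 'r set" where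
  "restricted_power n x d w = ideal_gen
     {\<Prod>i=1..n. x i ^ \<alpha> i | \<alpha> :: nat \<Rightarrow> nat. (\<forall>i\<in>{1..n}. \<alpha> i \<le> w i) \<and> (\<Sum>i=1..n. \<alpha> i) = d}"

end

theory Submission
  imports Defs
begin

text \<open>
  Write \<open>x i = \<psi> (f i)\<close>. By Nakayama's lemma in the local case, and by its graded analogue when the
  grading is bounded below, the \<open>x i\<close> form a regular sequence in any order. So each \<open>x t\<close> is regular
  modulo any set of the others, and hence also modulo powers of the others.

  As a module, \<open>L\<close> is the direct sum of its multidegree parts, and in multidegree \<open>\<mu> \<noteq> 0\<close> the
  map \<open>\<kappa>\<close> is the boundary of a full simplex on the support of \<open>\<mu>\<close>, which is a cone over any vertex
  \<open>v\<close>. So \<open>L\<close> is free: an element is determined by its coordinates \<open>f\<^sub>\<sigma> \<otimes> f\<^sup>\<alpha>\<close> with \<open>v \<notin> \<sigma>\<close>,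
  and these can be prescribed arbitrarily. Minimality is read
  off from the entries of \<open>Kos \<otimes> 1\<close> in the resulting basis.

  Exactness goes by induction on \<open>w\<close>. With \<open>v = i\<close>, the quotient of the complex for \<open>w\<close> by the one for
  \<open>w - \<epsilon>\<^sub>i\<close> is a direct sum of Koszul complexes, one for each \<open>\<beta>\<close> with \<open>\<beta> i = w i\<close>, on the \<open>x s\<close>
  with \<open>\<beta> s < w s\<close>. At the end of the complex, a relation \<open>\<Sum> r \<beta> x\<^sup>\<beta> = 0\<close> forces \<open>r \<beta>\<close> into the
  ideal of exactly these \<open>x s\<close>.
\<close>

section \<open>Monomial ideals and Koszul complexes of a permutable regular sequence\<close>

interpretation ring: module "(*) :: 'r::comm_ring_1 \<Rightarrow> 'r \<Rightarrow> 'r"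
  by (rule module_ring_self)

text \<open>As a rewrite rule on the ring itself this loops with associativity.\<close>
declare ring.scale_scale [simp del]

interpretation free: module "fscale :: 'r::comm_ring_1 \<Rightarrow> ('k \<Rightarrow>\<^sub>0 'r) \<Rightarrow> ('k \<Rightarrow>\<^sub>0 'r)"
  by (rule module_fscale)

text \<open>Regularity in every order at once: subsets replace lists, so that an induction may
  remove any variable.\<close>

definition subset_regular :: "(nat \<Rightarrow> 'r::comm_ring_1) \<Rightarrow> nat set \<Rightarrow> bool" where
  "subset_regular x N \<longleftrightarrow> (\<forall>S\<subseteq>N. \<forall>t\<in>N - S. \<forall>r.
     x t * r \<in> ideal_gen (x ` S) \<longrightarrow> r \<in> ideal_gen (x ` S))"

definition power_ideal :: "(nat \<Rightarrow> 'r::comm_ring_1) \<Rightarrow> (nat \<Rightarrow> nat) \<Rightarrow> nat set \<Rightarrow> 'r set" where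
  "power_ideal x a S = ideal_gen ((\<lambda>s. x s ^ a s) ` S)"

lemma is_ideal_power_ideal: "is_ideal (power_ideal x a S)"
  by (simp add: power_ideal_def)

lemma power_ideal_insert:
  "r \<in> power_ideal x a (insert u S) \<longleftrightarrow> (\<exists>k. r - k * x u ^ a u \<in> power_ideal x a S)"
  by (simp add: power_ideal_def ring.span_breakdown_eq)

lemma power_ideal_cong:
  "(\<And>s. s \<in> S \<Longrightarrow> a s = b s) \<Longrightarrow> power_ideal x a S = power_ideal x b S"
  unfolding power_ideal_def by (intro arg_cong[where f = ideal_gen] image_cong) auto

lemma power_nonzerodivisor:
  assumes "\<And>r :: 'r::comm_ring_1. y * r \<in> I \<Longrightarrow> r \<in> I" and "y ^ k * r \<in> I"
  shows "r \<in> I"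
  using assms(2) by (induction k) (auto simp: mult.assoc assms(1))

text \<open>Induction on the sum of the exponents; if all of them are 1, this is
  \<open>subset_regular\<close>. For \<open>a u = Suc b\<close> with \<open>b > 0\<close>, exponent
  \<open>b\<close> gives \<open>r = r' * x u ^ b\<close> modulo the other generators; after
  cancelling \<open>x u ^ b\<close>, exponent 1 shows that \<open>r'\<close> is a multiple of
  \<open>x u\<close>.\<close>

lemma power_ideal_nonzerodivisor:
  assumes x: "subset_regular x N" and "finite N"
  shows "S \<subseteq> N \<Longrightarrow> t \<in> N - S \<Longrightarrow> x t * r \<in> power_ideal x a S \<Longrightarrow> r \<in> power_ideal x a S"
proof (induction "\<Sum>s\<in>S. a s" arbitrary: S a t r rule: less_induct)
  case less
  have fin: "finite S" using less.prems(1) \<open>finite N\<close> finite_subset by blast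
  show ?case
  proof (cases "\<exists>u\<in>S. a u \<noteq> 1")
    case False
    then have "power_ideal x a S = ideal_gen (x ` S)"
      unfolding power_ideal_def by (intro arg_cong[where f = ideal_gen] image_cong) auto
    then show ?thesis using x less.prems unfolding subset_regular_def by blast
  next
    case True
    then obtain u where u: "u \<in> S" "a u \<noteq> 1" by blast
    define T where "T = S - {u}"
    have S: "S = insert u T" "u \<notin> T" "finite T" using u fin by (auto simp: T_def)
    show ?thesis
    proof (cases "a u")
      case 0
      \<comment> \<open>\<open>x u ^ 0 = 1\<close> is a generator, so the ideal is the whole
        ring.\<close>
      then show ?thesis using power_ideal_insert[of r x a u T] S
        by (metis diff_self is_ideal_power_ideal mult.right_neutral power_0 ring.subspace_0)
    next
      case (Suc b)
      \<comment> \<open>Now both \<open>b\<close> and 1 are smaller than \<open>a u\<close>, so the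
        induction hypothesis covers either exponent at \<open>u\<close>.\<close>
      with u have b: "b > 0" by simp
      let ?I = "power_ideal x a T"
      have T: "power_ideal x (a(u := c)) T = ?I" for c
        by (rule power_ideal_cong) (use S in auto)
      have sum: "(\<Sum>s\<in>S. (a(u := c)) s) = c + (\<Sum>s\<in>T. a s)" for c
        using S by (auto intro!: sum.cong)
      have sumS: "(\<Sum>s\<in>S. a s) = Suc b + (\<Sum>s\<in>T. a s)" using S Suc by simp
      obtain y where y: "x t * r - y * x u ^ Suc b \<in> ?I"
        using less.prems(3) unfolding S(1) power_ideal_insert Suc by blast
      have "x t * r - (y * x u) * x u ^ b \<in> ?I" using y by (simp only: mult.assoc power_Suc)
      then have "x t * r \<in> power_ideal x (a(u := b)) S"
        unfolding S(1) power_ideal_insert T fun_upd_same by blast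
      then have "r \<in> power_ideal x (a(u := b)) S"
        using less.hyps[where S = S and a = "a(u := b)" and t = t and r = r] less.prems sum[of b] sumS by simp
      then obtain r' where r': "r - r' * x u ^ b \<in> ?I"
        unfolding S(1) power_ideal_insert T fun_upd_same by blast
      have "(x t * r - y * x u ^ Suc b) - x t * (r - r' * x u ^ b) \<in> ?I"
        by (rule ring.subspace_diff[OF is_ideal_power_ideal y
            ring.subspace_scale[OF is_ideal_power_ideal r']])
      moreover have "(x t * r - y * x u ^ Suc b) - x t * (r - r' * x u ^ b) = x u ^ b * (x t * r' - x u * y)"
        by (simp add: algebra_simps)
      ultimately have *: "x u ^ b * (x t * r' - x u * y) \<in> ?I" by (simp only:)
      \<comment> \<open>Dropping \<open>u\<close> from \<open>S\<close> also lowers the sum, so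
        \<open>x u\<close> may be cancelled modulo the remaining generators.\<close>
      have nzd: "z \<in> ?I" if "x u * z \<in> ?I" for z
        using less.hyps[where S = T and a = a and t = u and r = z] that less.prems S sumS by auto
      have "x t * r' - y * x u ^ 1 \<in> ?I"
        using power_nonzerodivisor[OF nzd *] by (simp add: mult.commute)
      then have "x t * r' \<in> power_ideal x (a(u := 1)) S"
        unfolding S(1) power_ideal_insert T fun_upd_same by blast
      then have "r' \<in> power_ideal x (a(u := 1)) S"
        using less.hyps[where S = S and a = "a(u := 1)" and t = t and r = r'] less.prems sum[of 1] sumS b by simp
      then obtain k where k: "r' - k * x u \<in> ?I"
        unfolding S(1) power_ideal_insert T fun_upd_same power_one_right by blast
      have "(r - r' * x u ^ b) + x u ^ b * (r' - k * x u) \<in> ?I"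
        by (rule ring.subspace_add[OF is_ideal_power_ideal r'
            ring.subspace_scale[OF is_ideal_power_ideal k]])
      moreover have "(r - r' * x u ^ b) + x u ^ b * (r' - k * x u) = r - k * x u ^ a u"
        unfolding Suc by (simp add: algebra_simps)
      ultimately have "r - k * x u ^ a u \<in> ?I" by (simp only:)
      then show ?thesis unfolding S(1) power_ideal_insert by blast
    qed
  qed
qed

lemma power_ideal_prod_nonzerodivisor:
  assumes "subset_regular x N" "finite N" "S \<subseteq> N" "T \<subseteq> N - S"
    and "(\<Prod>t\<in>T. x t ^ b t) * r \<in> power_ideal x a S"
  shows "r \<in> power_ideal x a S"
proof -
  have "finite T" using assms finite_subset by blast
  then show ?thesis using assms(4,5)
  proof (induction T arbitrary: r rule: finite_induct)
    case (insert t T)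
    have "x t ^ b t * ((\<Prod>t\<in>T. x t ^ b t) * r) \<in> power_ideal x a S"
      using insert by (simp add: mult_ac)
    then have "(\<Prod>t\<in>T. x t ^ b t) * r \<in> power_ideal x a S"
      using power_nonzerodivisor power_ideal_nonzerodivisor[OF assms(1-3), of t] insert.prems
      by (metis insert_subset)
    then show ?case using insert by blast
  qed auto
qed

text \<open>One variable of \<open>T\<close> at a time: modulo the generators other than that of
  \<open>u\<close>, the power \<open>x u ^ b u\<close> can be cancelled, which turns the generator
  \<open>x u ^ Suc (b u)\<close> into \<open>x u\<close>.\<close>

lemma power_ideal_colon:
  assumes "subset_regular x N" "finite N" "S \<subseteq> N" "finite T" "T \<subseteq> S"
    and "(\<Prod>t\<in>T. x t ^ b t) * r \<in> power_ideal x (\<lambda>s. if s \<in> T then Suc (b s) else 1) S"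
  shows "r \<in> ideal_gen (x ` S)"
  using assms(4-)
proof (induction T rule: finite_induct)
  case empty
  then show ?case by (simp add: power_ideal_def)
next
  case (insert u T)
  let ?a = "\<lambda>T s. if s \<in> T then Suc (b s) else 1"
  define U where "U = S - {u}"
  have S: "S = insert u U" "u \<notin> U" "u \<in> N - U" "U \<subseteq> N" using insert assms by (auto simp: U_def)
  let ?I = "power_ideal x (?a T) U" and ?m = "\<Prod>t\<in>T. x t ^ b t"
  have U: "power_ideal x (?a (insert u T)) U = ?I"
    by (rule power_ideal_cong) (use S in auto)
  obtain k where "(\<Prod>t\<in>insert u T. x t ^ b t) * r - k * x u ^ ?a (insert u T) u \<in> ?I"
    using insert.prems(2) unfolding S(1) power_ideal_insert U by blast
  then have k: "(\<Prod>t\<in>insert u T. x t ^ b t) * r - k * x u ^ Suc (b u) \<in> ?I" by simp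
  then have "x u ^ b u * (?m * r - k * x u) \<in> ?I" using insert.hyps by (simp add: algebra_simps)
  then have "?m * r - k * x u \<in> ?I"
    using power_nonzerodivisor power_ideal_nonzerodivisor[OF assms(1,2) S(4,3)] by blast
  then have "?m * r \<in> power_ideal x (?a T) S"
    using insert.hyps unfolding S(1) power_ideal_insert by auto
  then show ?case using insert by blast
qed

text \<open>A relation between the monomials of degree \<open>d\<close> below \<open>w\<close>: any monomial other than \<open>\<beta>\<close>
  exceeds \<open>\<beta>\<close> in a coordinate \<open>s\<close> with \<open>\<beta> s < w s\<close>, so it lies in the ideal of the powers
  \<open>x s ^ (\<beta> s + 1)\<close>.\<close>

lemma restricted_relation_coefficient:
  fixes e :: "'i \<Rightarrow> nat \<Rightarrow> nat"
  assumes x: "subset_regular x N" and "finite N" and "finite A" and "\<beta> \<in> A"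
    and le: "\<And>\<gamma> s. \<gamma> \<in> A \<Longrightarrow> s \<in> N \<Longrightarrow> e \<gamma> s \<le> w s"
    and deg: "\<And>\<gamma>. \<gamma> \<in> A \<Longrightarrow> (\<Sum>s\<in>N. e \<gamma> s) = d"
    and neq: "\<And>\<gamma>. \<gamma> \<in> A \<Longrightarrow> \<gamma> \<noteq> \<beta> \<Longrightarrow> \<exists>s\<in>N. e \<gamma> s \<noteq> e \<beta> s"
    and rel: "(\<Sum>\<gamma>\<in>A. c \<gamma> * (\<Prod>s\<in>N. x s ^ e \<gamma> s)) = 0"
  shows "c \<beta> \<in> ideal_gen (x ` {s\<in>N. e \<beta> s < w s})"
proof -
  define S where "S = {s\<in>N. e \<beta> s < w s}"
  have SN: "S \<subseteq> N" "finite S" using \<open>finite N\<close> by (auto simp: S_def)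
  let ?I = "power_ideal x (\<lambda>s. Suc (e \<beta> s)) S"
  have mem: "(\<Prod>s\<in>N. x s ^ e \<gamma> s) \<in> ?I" if "\<gamma> \<in> A - {\<beta>}" for \<gamma>
  proof -
    have "\<exists>s\<in>N. e \<beta> s < e \<gamma> s"
    proof (rule ccontr)
      assume "\<not> (\<exists>s\<in>N. e \<beta> s < e \<gamma> s)"
      then have "\<forall>s\<in>N. e \<gamma> s \<le> e \<beta> s" by auto
      moreover obtain s where "s \<in> N" "e \<gamma> s \<noteq> e \<beta> s" using neq[of \<gamma>] \<open>\<gamma> \<in> A - {\<beta>}\<close> by blast
      ultimately have "(\<Sum>s\<in>N. e \<gamma> s) < (\<Sum>s\<in>N. e \<beta> s)"
        using \<open>finite N\<close> by (intro sum_strict_mono_ex1) (auto simp: order_less_le)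
      then show False using deg \<open>\<gamma> \<in> A - {\<beta>}\<close> \<open>\<beta> \<in> A\<close> by simp
    qed
    then obtain s where s: "s \<in> N" "e \<beta> s < e \<gamma> s" by blast
    then have "s \<in> S" using le[of \<gamma> s] that by (auto simp: S_def)
    then have "x s ^ Suc (e \<beta> s) \<in> ?I" unfolding power_ideal_def by (intro ring.span_base) auto
    moreover have "x s ^ Suc (e \<beta> s) dvd x s ^ e \<gamma> s" using s by (intro le_imp_power_dvd) simp
    then have "x s ^ Suc (e \<beta> s) dvd (\<Prod>s\<in>N. x s ^ e \<gamma> s)"
      by (rule dvd_trans) (rule dvd_prodI[where f = "\<lambda>s. x s ^ e \<gamma> s", OF \<open>finite N\<close> s(1)])
    then obtain k where "(\<Prod>s\<in>N. x s ^ e \<gamma> s) = k * x s ^ Suc (e \<beta> s)"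
      by (metis dvdE mult.commute)
    ultimately show ?thesis using ring.subspace_scale[OF is_ideal_power_ideal] by simp
  qed
  have "(\<Sum>\<gamma>\<in>A - {\<beta>}. c \<gamma> * (\<Prod>s\<in>N. x s ^ e \<gamma> s)) \<in> ?I"
    by (intro ring.subspace_sum ring.subspace_scale is_ideal_power_ideal mem)
  moreover have "c \<beta> * (\<Prod>s\<in>N. x s ^ e \<beta> s) = - (\<Sum>\<gamma>\<in>A - {\<beta>}. c \<gamma> * (\<Prod>s\<in>N. x s ^ e \<gamma> s))"
    using rel \<open>finite A\<close> \<open>\<beta> \<in> A\<close> by (simp add: sum.remove eq_neg_iff_add_eq_0)
  ultimately have "c \<beta> * (\<Prod>s\<in>N. x s ^ e \<beta> s) \<in> ?I"
    by (simp add: ring.subspace_neg is_ideal_power_ideal)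
  \<comment> \<open>The variables outside \<open>S\<close> are nonzerodivisors modulo
    \<open>?I\<close> and are cancelled first; the colon computation then disposes of those in
    \<open>S\<close>.\<close>
  moreover have "(\<Prod>s\<in>N. x s ^ e \<beta> s) = (\<Prod>s\<in>N - S. x s ^ e \<beta> s) * (\<Prod>s\<in>S. x s ^ e \<beta> s)"
    using SN \<open>finite N\<close> by (simp add: prod.subset_diff)
  ultimately have "(\<Prod>s\<in>N - S. x s ^ e \<beta> s) * ((\<Prod>s\<in>S. x s ^ e \<beta> s) * c \<beta>) \<in> ?I"
    by (simp add: mult_ac)
  then have "(\<Prod>s\<in>S. x s ^ e \<beta> s) * c \<beta> \<in> ?I"
    using power_ideal_prod_nonzerodivisor[OF x \<open>finite N\<close> SN(1), of "N - S"] by blast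
  also have "?I = power_ideal x (\<lambda>s. if s \<in> S then Suc (e \<beta> s) else 1) S"
    by (rule power_ideal_cong) auto
  finally show ?thesis
    using power_ideal_colon[OF x \<open>finite N\<close> SN] unfolding S_def by blast
qed

text \<open>The Koszul differential on the \<open>x s\<close> with \<open>s \<in> S\<close>, in
  coordinates: \<open>g\<close> lists the coefficients of a chain at the exterior basis elements,
  and the value at \<tau> is the coefficient of its boundary. One function carries all exterior
  degrees; \<open>card\<close> singles out one.\<close>

definition koszul :: "(nat \<Rightarrow> 'r::comm_ring_1) \<Rightarrow> nat set \<Rightarrow> (nat set \<Rightarrow> 'r) \<Rightarrow> nat set \<Rightarrow> 'r" where
  "koszul x S g \<tau> = (\<Sum>s\<in>S - \<tau>. position_sign \<tau> s * x s * g (insert s \<tau>))"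

lemma position_sign_insert_greater:
  "s < t \<Longrightarrow> position_sign (insert t \<tau>) s = position_sign \<tau> s"
  unfolding position_sign_def by (intro arg_cong[where f = "\<lambda>A. (-1) ^ card A"]) auto

lemma position_sign_max:
  "\<forall>s\<in>\<tau>. s < t \<Longrightarrow> position_sign \<tau> t = (-1) ^ card \<tau>"
  unfolding position_sign_def by (intro arg_cong[where f = "\<lambda>A. (-1) ^ card A"]) auto

text \<open>Adjoining a largest index presents the Koszul complex as a mapping cone. As
  \<open>t\<close> comes last, it does not affect the signs of the other indices, and its own sign
  depends only on \<open>card \<tau>\<close>.\<close>

lemma koszul_insert:
  assumes "finite S" "\<forall>s\<in>S. s < t" "\<tau> \<subseteq> S"
  shows "koszul x (insert t S) g \<tau> = koszul x S g \<tau> + (-1) ^ card \<tau> * x t * g (insert t \<tau>)"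
    and "koszul x (insert t S) g (insert t \<tau>) = koszul x S (\<lambda>\<rho>. g (insert t \<rho>)) \<tau>"
proof -
  have t: "t \<notin> S" "t \<notin> \<tau>" using assms by auto
  have "insert t S - \<tau> = insert t (S - \<tau>)" using t by auto
  moreover have "position_sign \<tau> t = ((-1) ^ card \<tau> :: 'a)"
    using assms by (intro position_sign_max) auto
  ultimately show "koszul x (insert t S) g \<tau> = koszul x S g \<tau> + (-1) ^ card \<tau> * x t * g (insert t \<tau>)"
    using t assms by (simp add: koszul_def)
  have "insert t S - insert t \<tau> = S - \<tau>" using t by auto
  then show "koszul x (insert t S) g (insert t \<tau>) = koszul x S (\<lambda>\<rho>. g (insert t \<rho>)) \<tau>"
    unfolding koszul_def using assms
    by (auto intro!: sum.cong simp: position_sign_insert_greater insert_commute)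
qed

lemma koszul_cong:
  "(\<And>s. s \<in> S - \<tau> \<Longrightarrow> g (insert s \<tau>) = h (insert s \<tau>)) \<Longrightarrow> koszul x S g \<tau> = koszul x S h \<tau>"
  unfolding koszul_def by (auto intro!: sum.cong)

lemma koszul_lincomb:
  "koszul x S (\<lambda>\<rho>. g \<rho> + c * h \<rho>) \<tau> = koszul x S g \<tau> + c * koszul x S h \<tau>"
  unfolding koszul_def by (simp add: sum.distrib algebra_simps sum_distrib_left)

lemma koszul_empty_in_ideal_gen: "koszul x S g {} \<in> ideal_gen (x ` S)"
  unfolding koszul_def
proof (rule ring.span_sum)
  fix s assume "s \<in> S - {}"
  then have "(position_sign {} s * g {s}) * x s \<in> ideal_gen (x ` S)"
    by (intro ring.span_scale ring.span_base) auto
  then show "position_sign {} s * x s * g {s} \<in> ideal_gen (x ` S)" by (simp only: mult_ac)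
qed

lemma ideal_gen_eq_koszul:
  assumes "finite S" "r \<in> ideal_gen (x ` S)"
  shows "\<exists>g. r = koszul x S g {}"
  using assms
proof (induction S arbitrary: r rule: finite_induct)
  case empty
  then show ?case by (simp add: koszul_def)
next
  case (insert t S)
  then obtain k where "r - k * x t \<in> ideal_gen (x ` S)" by (auto simp: ring.span_breakdown_eq)
  then obtain g where g: "r - k * x t = koszul x S g {}" using insert by blast
  have "koszul x (insert t S) (g({t} := k)) {} = x t * k + koszul x S (g({t} := k)) {}"
    using insert by (simp add: koszul_def position_sign_def)
  also have "koszul x S (g({t} := k)) {} = koszul x S g {}"
    using insert by (intro koszul_cong) auto
  finally show ?case using g by (metis add.commute diff_add_cancel mult.commute)
qed

text \<open>Acyclicity by induction along the mapping cone: first the part of \<open>g\<close> at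
  sets containing \<open>t\<close> is bounded over \<open>S\<close>, then the rest of
  \<open>g\<close> after a correction.\<close>

lemma koszul_exact:
  fixes x :: "nat \<Rightarrow> 'r::comm_ring_1"
  assumes "subset_regular x N" "finite N" "S \<subseteq> N"
    and "\<And>\<tau>. \<tau> \<subseteq> S \<Longrightarrow> card \<tau> = b \<Longrightarrow> koszul x S g \<tau> = 0"
  shows "\<exists>h. \<forall>\<tau>\<subseteq>S. card \<tau> = Suc b \<longrightarrow> g \<tau> = koszul x S h \<tau>"
proof -
  have "finite S" using assms finite_subset by blast
  then show ?thesis using assms(3,4)
  proof (induction S arbitrary: b g rule: finite_linorder_max_induct)
    case empty
    then show ?case by auto
  next
    case (insert t S)
    note K = koszul_insert[OF insert.hyps(1,2)]
    have t: "t \<notin> S" using insert by auto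
    have ct: "card (insert t \<tau>) = Suc (card \<tau>)" if "\<tau> \<subseteq> S" for \<tau>
      using that t insert.hyps(1) by (meson card_insert_disjoint finite_subset subsetD)
    \<comment> \<open>For \<open>b > 0\<close> the part with \<open>t\<close> is itself a cycle over
      \<open>S\<close>. For \<open>b = 0\<close> it is the single coefficient \<open>g {t}\<close>,
      and regularity of \<open>x t\<close> modulo the other variables puts it into their
      ideal.\<close>
    obtain g1 where g1: "\<And>\<tau>. \<tau> \<subseteq> S \<Longrightarrow> card \<tau> = b \<Longrightarrow> g (insert t \<tau>) = koszul x S g1 \<tau>"
    proof (cases b)
      case 0
      have "koszul x S g {} + x t * g {t} = 0"
        using insert.prems(2)[of "{}"] K(1)[of "{}" x g] 0 by simp
      then have "x t * g {t} = - koszul x S g {}" by (metis add.commute eq_neg_iff_add_eq_0)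
      then have "x t * g {t} \<in> ideal_gen (x ` S)"
        using ring.span_neg[OF koszul_empty_in_ideal_gen] by metis
      then have "g {t} \<in> ideal_gen (x ` S)"
        using assms(1) insert.prems(1) t unfolding subset_regular_def by blast
      then obtain h where "g {t} = koszul x S h {}"
        using ideal_gen_eq_koszul insert.hyps(1) by blast
      then show ?thesis using 0 that[of h] insert.hyps(1) by (metis card_0_eq finite_subset)
    next
      case (Suc c)
      have "koszul x S (\<lambda>\<rho>. g (insert t \<rho>)) \<tau> = 0" if "\<tau> \<subseteq> S" "card \<tau> = c" for \<tau>
        using insert.prems(2)[of "insert t \<tau>"] K(2)[of \<tau> x g] that Suc ct[of \<tau>] by auto
      then show ?thesis using insert.IH[of c "\<lambda>\<rho>. g (insert t \<rho>)"] insert.prems(1) Suc that by auto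
    qed
    \<comment> \<open>At a set without \<open>t\<close> the boundary of \<open>g\<close> is its
      boundary over \<open>S\<close> plus \<open>?c\<close> times the part with \<open>t\<close>.
      That part is the boundary of \<open>g1\<close>, so \<open>g + ?c * g1\<close> is a cycle over
      \<open>S\<close>.\<close>
    let ?c = "(-1) ^ b * x t"
    have "koszul x S (\<lambda>\<rho>. g \<rho> + ?c * g1 \<rho>) \<tau> = 0" if "\<tau> \<subseteq> S" "card \<tau> = b" for \<tau>
      using insert.prems(2)[of \<tau>] that K(1)[of \<tau> x g] g1[OF that] by (auto simp: koszul_lincomb)
    then obtain g0 where g0: "\<And>\<tau>. \<tau> \<subseteq> S \<Longrightarrow> card \<tau> = Suc b \<Longrightarrow> g \<tau> + ?c * g1 \<tau> = koszul x S g0 \<tau>"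
      using insert.IH[of b "\<lambda>\<rho>. g \<rho> + ?c * g1 \<rho>"] insert.prems(1) by auto
    define h where "h \<rho> = (if t \<in> \<rho> then g1 (\<rho> - {t}) else g0 \<rho>)" for \<rho>
    have h: "h (insert t \<rho>) = g1 \<rho>" if "t \<notin> \<rho>" for \<rho> using that by (simp add: h_def)
    have outside: "g \<tau> = koszul x (insert t S) h \<tau>" if \<tau>: "\<tau> \<subseteq> S" "card \<tau> = Suc b" for \<tau>
    proof -
      have "t \<notin> \<tau>" using \<tau> t by auto
      then have "koszul x S h \<tau> = koszul x S g0 \<tau>"
        by (intro koszul_cong) (use t in \<open>auto simp: h_def\<close>)
      \<comment> \<open>Here \<open>card \<tau> = Suc b\<close>, so the sign at \<open>t\<close> is
        opposite to the one in \<open>?c\<close> and the correction is undone.\<close>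
      then have "koszul x (insert t S) h \<tau> + ?c * g1 \<tau> = koszul x S g0 \<tau>"
        using K(1)[OF \<tau>(1), of x h] h[OF \<open>t \<notin> \<tau>\<close>] \<tau>(2) by simp
      then show ?thesis using g0[OF \<tau>] by (metis add_right_cancel)
    qed
    have inside: "g (insert t \<tau>) = koszul x (insert t S) h (insert t \<tau>)"
      if \<tau>: "\<tau> \<subseteq> S" "card \<tau> = b" for \<tau>
    proof -
      have "t \<notin> \<tau>" using \<tau> t by auto
      then have "koszul x S (\<lambda>\<rho>. h (insert t \<rho>)) \<tau> = koszul x S g1 \<tau>"
        by (intro koszul_cong h) (use t in auto)
      then show ?thesis using K(2)[OF \<tau>(1), of x h] g1[OF \<tau>] by simp
    qed
    have "g \<tau> = koszul x (insert t S) h \<tau>" if \<tau>: "\<tau> \<subseteq> insert t S" "card \<tau> = Suc b" for \<tau>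
    proof (cases "t \<in> \<tau>")
      case True
      then obtain \<rho> where "\<tau> = insert t \<rho>" "t \<notin> \<rho>" by (meson mk_disjoint_insert)
      moreover from this have "\<rho> \<subseteq> S" using \<tau> by auto
      ultimately show ?thesis using inside[of \<rho>] ct[of \<rho>] \<tau> by simp
    next
      case False
      then show ?thesis using outside \<tau> by blast
    qed
    then show ?case by blast
  qed
qed

section \<open>Permuting regular sequences\<close>

definition nonzerodivisor_mod :: "'r::comm_ring_1 set \<Rightarrow> 'r \<Rightarrow> bool" where
  "nonzerodivisor_mod I y \<longleftrightarrow> (\<forall>r. y * r \<in> I \<longrightarrow> r \<in> I)"

text \<open>Regularity relative to a set \<open>A\<close> of entries already passed, which is the
  form that an induction along the list needs.\<close>

fun weakly_regular_mod :: "'r::comm_ring_1 set \<Rightarrow> 'r list \<Rightarrow> bool" where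
  "weakly_regular_mod A [] \<longleftrightarrow> True"
| "weakly_regular_mod A (y # ys) \<longleftrightarrow>
     nonzerodivisor_mod (ideal_gen A) y \<and> weakly_regular_mod (insert y A) ys"

lemma weakly_regular_mod_iff:
  "weakly_regular_mod A xs \<longleftrightarrow>
     (\<forall>i<length xs. nonzerodivisor_mod (ideal_gen (A \<union> set (take i xs))) (xs ! i))"
  by (induction A xs rule: weakly_regular_mod.induct) (simp_all add: All_less_Suc2)

lemma regular_sequence_iff:
  "regular_sequence xs \<longleftrightarrow> weakly_regular_mod {} xs \<and> ideal_gen (set xs) \<noteq> UNIV"
  by (simp add: regular_sequence_def weakly_regular_mod_iff nonzerodivisor_mod_def)

text \<open>Isolates the one step of permuting a regular sequence that is not formal; the local and
  the graded case each supply it by a Nakayama argument.\<close>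

locale swappable =
  fixes X :: "'r::comm_ring_1 set"
  assumes cancel: "\<lbrakk>finite A; A \<subseteq> X; x \<in> X; y \<in> X; nonzerodivisor_mod (ideal_gen A) x;
    nonzerodivisor_mod (ideal_gen (insert x A)) y\<rbrakk> \<Longrightarrow> nonzerodivisor_mod (ideal_gen A) y"
begin

text \<open>Only the new condition on \<open>y\<close> uses \<open>cancel\<close>. The one on
  \<open>x\<close> is formal: if \<open>x * r = b * y\<close> modulo \<open>A\<close>, then
  \<open>b = c * x\<close> modulo \<open>A\<close> by regularity of \<open>y\<close>, and cancelling
  \<open>x\<close> leaves \<open>r = c * y\<close>.\<close>

lemma swap:
  assumes "finite A" "insert x (insert y A) \<subseteq> X" "weakly_regular_mod A (x # y # ys)"
  shows "weakly_regular_mod A (y # x # ys)"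
proof -
  let ?I = "ideal_gen A"
  have x: "nonzerodivisor_mod ?I x" and y: "nonzerodivisor_mod (ideal_gen (insert x A)) y"
    using assms by auto
  have "r \<in> ideal_gen (insert y A)" if r: "x * r \<in> ideal_gen (insert y A)" for r
  proof -
    obtain b where b: "x * r - b * y \<in> ?I" using r unfolding ring.span_breakdown_eq by blast
    have "- (x * r - b * y) \<in> ?I" using b by (rule ring.span_neg)
    then have "y * b - r * x \<in> ?I" by (simp add: algebra_simps)
    then have "b \<in> ideal_gen (insert x A)"
      using y unfolding nonzerodivisor_mod_def ring.span_breakdown_eq by blast
    then obtain c where c: "b - c * x \<in> ?I" unfolding ring.span_breakdown_eq by blast
    have "(x * r - b * y) + y * (b - c * x) \<in> ?I"
      using b c by (intro ring.span_add ring.span_scale)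
    then have "x * (r - c * y) \<in> ?I" by (simp add: algebra_simps)
    then have "r - c * y \<in> ?I" using x by (simp add: nonzerodivisor_mod_def)
    then show ?thesis unfolding ring.span_breakdown_eq by blast
  qed
  then have "nonzerodivisor_mod (ideal_gen (insert y A)) x" by (simp add: nonzerodivisor_mod_def)
  moreover have "nonzerodivisor_mod ?I y" using cancel[OF _ _ _ _ x y] assms(1,2) by blast
  ultimately show ?thesis using assms(3) by (simp add: insert_commute)
qed

lemma move_to_front:
  assumes "finite A" "A \<union> set (us @ y # vs) \<subseteq> X" "weakly_regular_mod A (us @ y # vs)"
  shows "weakly_regular_mod A (y # us @ vs)"
  using assms
proof (induction us arbitrary: A)
  case (Cons u us)
  then have "weakly_regular_mod A (u # y # us @ vs)"
    using Cons.IH[of "insert u A"] by simp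
  then show ?case using swap[of A u y "us @ vs"] Cons.prems by simp
qed simp

lemma weakly_regular_permute:
  assumes "finite A" "A \<union> set xs \<subseteq> X" "weakly_regular_mod A xs" "mset ys = mset xs"
  shows "weakly_regular_mod A ys"
  using assms
proof (induction ys arbitrary: A xs)
  case (Cons y ys)
  then have "y \<in> set xs" by (metis list.set_intros(1) set_mset_mset)
  then obtain us vs where xs: "xs = us @ y # vs" by (meson split_list)
  then have "weakly_regular_mod A (y # us @ vs)" using move_to_front Cons.prems by blast
  moreover have "mset ys = mset (us @ vs)" using Cons.prems(4) xs by simp
  ultimately show ?case
    using Cons.IH[of "insert y A" "us @ vs"] Cons.prems xs by auto
qed simp

end

lemma swappable_imp_permutably_regular:
  assumes "swappable (set xs)" "regular_sequence xs"
  shows "permutably_regular xs"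
  unfolding permutably_regular_def
proof (intro allI impI)
  fix ys assume ys: "mset ys = mset xs"
  then show "regular_sequence ys"
    using swappable.weakly_regular_permute[OF assms(1), of "{}" xs ys] assms(2)
      mset_eq_setD[OF ys] by (simp add: regular_sequence_iff)
qed

text \<open>The rearrangement to use lists \<open>S\<close> first, then \<open>t\<close>, then the
  remaining indices.\<close>

lemma permutably_regular_imp_subset_regular:
  assumes "permutably_regular (map x [1..<Suc n])"
  shows "subset_regular x {1..n}"
  unfolding subset_regular_def
proof (intro allI impI ballI)
  fix S t r assume S: "S \<subseteq> {1..n}" and t: "t \<in> {1..n} - S" and r: "x t * r \<in> ideal_gen (x ` S)"
  define as where "as = sorted_list_of_set S"
  define bs where "bs = sorted_list_of_set ({1..n} - S - {t})"
  have fin: "finite S" using S finite_subset by blast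
  have d: "distinct (as @ t # bs)" using t fin by (auto simp: as_def bs_def)
  have "set (as @ t # bs) = set [1..<Suc n]" using S t fin by (auto simp: as_def bs_def)
  then have "mset (as @ t # bs) = mset [1..<Suc n]" using d by (simp only: set_eq_iff_mset_eq_distinct distinct_upt)
  then have "mset (map x (as @ t # bs)) = mset (map x [1..<Suc n])" by (metis mset_map)
  then have reg: "regular_sequence (map x (as @ t # bs))"
    using assms unfolding permutably_regular_def by blast
  have "set (take (length as) (map x (as @ t # bs))) = x ` S"
    using fin by (simp add: as_def)
  moreover have "map x (as @ t # bs) ! length as = x t" by (simp add: nth_append)
  moreover have "length as < length (map x (as @ t # bs))" by simp
  ultimately show "r \<in> ideal_gen (x ` S)" using reg r unfolding regular_sequence_def by metis
qed

section \<open>Noetherian local rings\<close>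

lemma is_ideal_UNIV_iff: "is_ideal I \<Longrightarrow> I = UNIV \<longleftrightarrow> 1 \<in> I"
  using ring.subspace_scale[of I 1] by auto

lemma proper_ideal_le_maximal_ideal:
  assumes "is_ideal I" "1 \<notin> I"
  shows "\<exists>M. maximal_ideal M \<and> I \<subseteq> M"
proof -
  define P where "P = {K. is_ideal K \<and> I \<subseteq> K \<and> 1 \<notin> K}"
  have "\<exists>U\<in>P. \<forall>K\<in>C. K \<subseteq> U" if C: "subset.chain P C" for C
  proof (cases "C = {}")
    case True
    then show ?thesis using assms by (auto simp: P_def)
  next
    case False
    have CP: "\<And>K. K \<in> C \<Longrightarrow> is_ideal K \<and> I \<subseteq> K \<and> 1 \<notin> K"
      using C by (auto simp: subset.chain_def P_def)
    have "is_ideal (\<Union>C)"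
    proof (rule ring.subspaceI)
      show "0 \<in> \<Union>C" using False CP ring.subspace_0 by blast
      show "a + b \<in> \<Union>C" if ab: "a \<in> \<Union>C" "b \<in> \<Union>C" for a b
      proof -
        obtain K L where KL: "K \<in> C" "L \<in> C" "a \<in> K" "b \<in> L" using ab by blast
        then have "K \<subseteq> L \<or> L \<subseteq> K" using C unfolding subset.chain_def by blast
        then show ?thesis using KL CP ring.subspace_add by (metis UnionI subsetD)
      qed
      show "c * a \<in> \<Union>C" if "a \<in> \<Union>C" for a c
        using that CP ring.subspace_scale by blast
    qed
    then have "\<Union>C \<in> P" using False CP by (auto simp: P_def)
    then show ?thesis by blast
  qed
  then have "\<exists>M\<in>P. \<forall>K\<in>P. M \<subseteq> K \<longrightarrow> K = M" by (rule subset_Zorn)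
  then obtain M where M: "M \<in> P" "\<And>K. K \<in> P \<Longrightarrow> M \<subseteq> K \<Longrightarrow> K = M" by blast
  then have "maximal_ideal M"
    unfolding maximal_ideal_def P_def by (auto simp: is_ideal_UNIV_iff)
  then show ?thesis using M by (auto simp: P_def)
qed

lemma proper_ideal_le_local:
  assumes "local_with_maximal_ideal J" "is_ideal I" "I \<noteq> UNIV"
  shows "I \<subseteq> J"
  using proper_ideal_le_maximal_ideal[OF assms(2)] assms is_ideal_UNIV_iff[OF assms(2)]
  unfolding local_with_maximal_ideal_def by blast

text \<open>Otherwise \<open>1 - x * b\<close> generates a proper ideal, hence lies in
  \<open>J\<close> together with \<open>x * b\<close>, and 1 would lie in \<open>J\<close>.\<close>

lemma local_one_minus_unit:
  assumes J: "local_with_maximal_ideal J" and "x \<in> J"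
  shows "(1 - x * b) dvd 1"
proof (rule ccontr)
  assume "\<not> (1 - x * b) dvd 1"
  then have "1 \<notin> ideal_gen {1 - x * b}"
    by (auto simp: ring.span_singleton dvd_def mult.commute)
  then have "ideal_gen {1 - x * b} \<subseteq> J"
    using proper_ideal_le_local[OF J] by (metis UNIV_I ring.subspace_span)
  then have "1 - x * b \<in> J" using ring.span_base by blast
  moreover have JI: "is_ideal J" "J \<noteq> UNIV"
    using J by (auto simp: local_with_maximal_ideal_def maximal_ideal_def)
  moreover have "x * b \<in> J" using ring.subspace_scale[OF JI(1) \<open>x \<in> J\<close>, of b] by (simp add: mult.commute)
  ultimately have "1 \<in> J" using ring.subspace_add[of J "1 - x * b" "x * b"] by simp
  then show False using JI is_ideal_UNIV_iff by blast
qed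

text \<open>Nakayama's lemma for \<open>(T) \<subseteq> x (T) + I\<close>, by elimination of
  generators: the relation of \<open>t\<close> is solved for \<open>t\<close>, because
  \<open>1 - x * c\<close> is a unit, and substituted into the other relations.\<close>

lemma nakayama_principal:
  fixes x :: "'r::comm_ring_1"
  assumes I: "is_ideal I" and unit: "\<And>b. (1 - x * b) dvd 1" and "finite T"
    and "\<And>t. t \<in> T \<Longrightarrow> \<exists>b\<in>ideal_gen T. t - x * b \<in> I"
  shows "T \<subseteq> I"
  using assms(3,4)
proof (induction T rule: finite_induct)
  case (insert t T)
  obtain b where b: "b \<in> ideal_gen (insert t T)" "t - x * b \<in> I" using insert.prems by blast
  then obtain c where c: "b - c * t \<in> ideal_gen T" unfolding ring.span_breakdown_eq by blast
  obtain u where u: "1 = (1 - x * c) * u" using unit[of c] unfolding dvd_def by blast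
  \<comment> \<open>From \<open>t = x * b\<close> modulo \<open>I\<close> follows
    \<open>(1 - x * c) * t = x * (b - c * t)\<close>; multiplying by the inverse \<open>u\<close>
    gives \<open>t = x * b'\<close>, where \<open>b'\<close> no longer involves
    \<open>t\<close>.\<close>
  define b' where "b' = u * (b - c * t)"
  have b': "b' \<in> ideal_gen T" unfolding b'_def using c by (rule ring.span_scale)
  have "u * (t - x * b) = ((1 - x * c) * u) * t - x * b'"
    unfolding b'_def by (simp add: algebra_simps)
  also have "\<dots> = t - x * b'" unfolding u[symmetric] by simp
  finally have t: "t - x * b' \<in> I" using ring.subspace_scale[OF I b(2), of u] by (simp only:)
  have "\<exists>b\<in>ideal_gen T. s - x * b \<in> I" if s: "s \<in> T" for s
  proof -
    obtain d where d: "d \<in> ideal_gen (insert t T)" "s - x * d \<in> I" using insert.prems s by blast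
    then obtain k where k: "d - k * t \<in> ideal_gen T" unfolding ring.span_breakdown_eq by blast
    \<comment> \<open>This is \<open>d\<close> with its summand \<open>k * t\<close> replaced by
      \<open>k * (x * b')\<close>.\<close>
    define e where "e = (d - k * t) + (x * k) * b'"
    have "e \<in> ideal_gen T"
      unfolding e_def by (intro ring.span_add k ring.span_scale b')
    moreover have "s - x * e = (s - x * d) + (x * k) * (t - x * b')"
      by (simp add: e_def algebra_simps)
    ultimately show ?thesis
      using ring.subspace_add[OF I d(2) ring.subspace_scale[OF I t]] by metis
  qed
  then have T: "T \<subseteq> I" using insert.IH by blast
  then have "b' \<in> I" using b' ring.span_minimal[OF _ I] by blast
  then have "(t - x * b') + x * b' \<in> I" using t I by (intro ring.subspace_add ring.subspace_scale)
  then show ?case using T by simp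
qed simp

text \<open>Let \<open>N\<close> be the colon ideal of \<open>ideal_gen A\<close> by
  \<open>y\<close>. An element of \<open>N\<close> is a multiple of \<open>x\<close> modulo
  \<open>A\<close>, and cancelling \<open>x\<close> shows that the cofactor is again in
  \<open>N\<close>, so \<open>N \<subseteq> x N + ideal_gen A\<close>. As \<open>N\<close> is
  finitely generated, Nakayama applies.\<close>

lemma noetherian_local_swappable:
  assumes noeth: "noetherian TYPE('r::comm_ring_1)" and J: "local_with_maximal_ideal (J :: 'r set)"
    and "X \<subseteq> J"
  shows "swappable X"
proof
  fix A x y
  assume "x \<in> X" and x: "nonzerodivisor_mod (ideal_gen A) x"
    and y: "nonzerodivisor_mod (ideal_gen (insert x A)) y"
  let ?I = "ideal_gen A"
  define N where "N = {r. y * r \<in> ?I}"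
  have "is_ideal N"
    unfolding N_def
    by (rule ring.subspaceI) (simp_all add: distrib_left ring.span_zero ring.span_add
        mult.left_commute[of y] ring.span_scale)
  then obtain T where T: "finite T" "N = ideal_gen T" using noeth unfolding noetherian_def by blast
  have "\<exists>b\<in>N. t - x * b \<in> ?I" if "t \<in> N" for t
  proof -
    have "y * t \<in> ideal_gen (insert x A)"
      using that ring.span_mono[of A "insert x A"] by (auto simp: N_def)
    then have "t \<in> ideal_gen (insert x A)" using y by (simp add: nonzerodivisor_mod_def)
    then obtain b where b: "t - b * x \<in> ?I" unfolding ring.span_breakdown_eq by blast
    have "y * t - y * (t - b * x) \<in> ?I"
      using that b ring.span_diff ring.span_scale unfolding N_def by blast
    then have "x * (y * b) \<in> ?I" by (simp add: algebra_simps)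
    then have "b \<in> N" using x by (simp add: nonzerodivisor_mod_def N_def)
    then show ?thesis using b by (auto simp: mult.commute)
  qed
  then have "T \<subseteq> ?I"
    using T ring.span_base[of _ T] local_one_minus_unit[OF J, of x] \<open>x \<in> X\<close> \<open>X \<subseteq> J\<close>
    by (intro nakayama_principal[of ?I x]) auto
  then have "N \<subseteq> ?I" unfolding T(2) by (rule ring.span_minimal) simp
  then show "nonzerodivisor_mod ?I y" by (auto simp: nonzerodivisor_mod_def N_def)
qed

section \<open>Graded rings\<close>

locale graded_ring =
  fixes G :: "int \<Rightarrow> 'r::comm_ring_1 set"
  assumes grading: "int_grading G"
begin

definition component :: "'r \<Rightarrow> int \<Rightarrow> 'r" where
  "component r = Poly_Mapping.lookup (THE c. (\<forall>k. Poly_Mapping.lookup c k \<in> G k) \<and>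
     r = (\<Sum>k\<in>Poly_Mapping.keys c. Poly_Mapping.lookup c k))"

lemma zero_in: "0 \<in> G k"
  using grading unfolding int_grading_def by blast

lemma add_in: "a \<in> G k \<Longrightarrow> b \<in> G k \<Longrightarrow> a + b \<in> G k"
  using grading zero_in[of k] unfolding int_grading_def by (metis diff_0 diff_minus_eq_add)

lemma mult_in: "a \<in> G i \<Longrightarrow> b \<in> G j \<Longrightarrow> a * b \<in> G (i + j)"
  using grading unfolding int_grading_def by blast

lemma unique_decomposition:
  "\<exists>!c. (\<forall>k. Poly_Mapping.lookup c k \<in> G k) \<and>
     r = (\<Sum>k\<in>Poly_Mapping.keys c. Poly_Mapping.lookup c k)"
  using grading unfolding int_grading_def by blast

lemma component_in: "component r k \<in> G k"
  and finite_component: "finite {k. component r k \<noteq> 0}"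
  and sum_component: "r = (\<Sum>k | component r k \<noteq> 0. component r k)"
  using theI'[OF unique_decomposition[of r]] by (simp_all add: component_def Poly_Mapping.keys.rep_eq)

lemma component_eqI:
  assumes "finite K" "\<And>k. u k \<in> G k" "\<And>k. k \<notin> K \<Longrightarrow> u k = 0" "r = (\<Sum>k\<in>K. u k)"
  shows "component r k = u k"
proof -
  have fin: "finite {k. u k \<noteq> 0}" by (rule finite_subset[OF _ assms(1)]) (use assms(3) in auto)
  define c where "c = Abs_poly_mapping u"
  have c: "Poly_Mapping.lookup c = u" using fin by (simp add: c_def)
  have "r = (\<Sum>k\<in>Poly_Mapping.keys c. Poly_Mapping.lookup c k)"
    unfolding assms(4) Poly_Mapping.keys.rep_eq c using assms(1,3)
    by (intro sum.mono_neutral_right) auto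
  then have "(THE c. (\<forall>k. Poly_Mapping.lookup c k \<in> G k) \<and>
     r = (\<Sum>k\<in>Poly_Mapping.keys c. Poly_Mapping.lookup c k)) = c"
    using unique_decomposition[of r] c assms(2) by (intro the1_equality) auto
  then show ?thesis by (simp add: component_def c)
qed

lemma component_homogeneous: "r \<in> G k \<Longrightarrow> component r j = (if j = k then r else 0)"
  by (rule component_eqI[of "{k}"]) (auto simp: zero_in)

lemma component_add: "component (a + b) k = component a k + component b k"
proof (rule component_eqI)
  let ?K = "\<lambda>a. {k. component a k \<noteq> 0}"
  show "finite (?K a \<union> ?K b)" using finite_component by blast
  have "(\<Sum>k\<in>?K a \<union> ?K b. component a k) = a" "(\<Sum>k\<in>?K a \<union> ?K b. component b k) = b"
    by (subst (5) sum_component, intro sum.mono_neutral_right; auto simp: finite_component)+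
  then show "a + b = (\<Sum>k\<in>?K a \<union> ?K b. component a k + component b k)"
    by (simp add: sum.distrib)
qed (auto intro: add_in component_in)

lemma component_mult:
  assumes "y \<in> G e"
  shows "component (r * y) k = component r (k - e) * y"
proof (rule component_eqI)
  let ?K = "{k. component r k \<noteq> 0}"
  show "finite ((\<lambda>k. k + e) ` ?K)" using finite_component by blast
  have "r * y = (\<Sum>k\<in>?K. component r k) * y" by (subst sum_component) rule
  also have "\<dots> = (\<Sum>k\<in>(\<lambda>k. k + e) ` ?K. component r (k - e) * y)"
    by (subst sum.reindex) (auto simp: inj_on_def sum_distrib_right)
  finally show "r * y = \<dots>" .
  show "component r (k - e) * y \<in> G k" for k
    using mult_in[OF component_in assms, of r "k - e"] by simp
  show "component r (k - e) * y = 0" if "k \<notin> (\<lambda>k. k + e) ` ?K" for k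
  proof -
    have "component r (k - e) = 0" using that by (metis (mono_tags) diff_add_cancel image_eqI mem_Collect_eq)
    then show ?thesis by simp
  qed
qed

text \<open>For homogeneous \<open>a\<close>, the components of \<open>c * a\<close> are components
  of \<open>c\<close> times \<open>a\<close>, so they do not leave the ideal.\<close>

lemma component_in_ideal:
  assumes "A \<subseteq> (\<Union>k. G k)" "r \<in> ideal_gen A"
  shows "component r k \<in> ideal_gen A"
  using assms(2)
proof (induction arbitrary: k rule: ring.span_induct_alt)
  case base
  then show ?case using component_homogeneous[OF zero_in] by (simp add: ring.span_zero)
next
  case (step c a b)
  then obtain e where "a \<in> G e" using assms(1) by blast
  then show ?case
    unfolding component_add component_mult[OF \<open>a \<in> G e\<close>]
    by (intro ring.span_add ring.span_scale ring.span_base step)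
qed

text \<open>A graded Nakayama argument by descent: a homogeneous \<open>r\<close> with
  \<open>y * r\<close> in the ideal of \<open>A\<close> equals \<open>s * x\<close> modulo that
  ideal, where \<open>s\<close> is homogeneous of smaller degree and has the same property. The
  descent ends below the bound of the grading. A general \<open>r\<close> is split into components,
  as the ideal is homogeneous.\<close>

lemma bounded_below_swappable:
  assumes bdd: "bounded_below G" and X: "\<And>x. x \<in> X \<Longrightarrow> \<exists>e>0. x \<in> G e"
  shows "swappable X"
proof
  fix A x y
  assume "A \<subseteq> X" "x \<in> X" "y \<in> X" and x: "nonzerodivisor_mod (ideal_gen A) x"
    and y: "nonzerodivisor_mod (ideal_gen (insert x A)) y"
  let ?I = "ideal_gen A"
  obtain e m where e: "e > 0" "x \<in> G e" and m: "y \<in> G m" using X \<open>x \<in> X\<close> \<open>y \<in> X\<close> by blast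
  have A: "A \<subseteq> (\<Union>k. G k)" using X \<open>A \<subseteq> X\<close> by blast
  obtain M where M: "\<And>k. k < M \<Longrightarrow> G k = {0}" using bdd by (auto simp: bounded_below_def)
  have homogeneous: "r \<in> ?I" if "r \<in> G k" "y * r \<in> ?I" for r k
    using that
  \<comment> \<open>The measure is positive while \<open>k \<ge> M\<close>, so lowering the degree
    by \<open>e > 0\<close> strictly decreases it.\<close>
  proof (induction "nat (k - M + 1)" arbitrary: k r rule: less_induct)
    case less
    show ?case
    proof (cases "k < M")
      case True
      then show ?thesis using M less.prems by (auto simp: ring.span_zero)
    next
      case False
      have "y * r \<in> ideal_gen (insert x A)"
        using less.prems(2) ring.span_mono[of A "insert x A"] by auto
      then have "r \<in> ideal_gen (insert x A)" using y by (simp add: nonzerodivisor_mod_def)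
      then obtain b where b: "r - b * x \<in> ?I" unfolding ring.span_breakdown_eq by blast
      \<comment> \<open>Since \<open>r\<close> and \<open>x\<close> are homogeneous, comparing
        components of degree \<open>k\<close> allows \<open>b\<close> to be replaced by its part of
        degree \<open>k - e\<close>.\<close>
      define s where "s = component b (k - e)"
      have "component ((r - b * x) + b * x) k = component (r - b * x) k + s * x"
        unfolding s_def component_add component_mult[OF e(2)] ..
      then have "r - s * x = component (r - b * x) k"
        using component_homogeneous[OF less.prems(1), of k] by (simp add: diff_eq_eq)
      then have s: "r - s * x \<in> ?I" using component_in_ideal[OF A b, of k] by simp
      have "y * r - y * (r - s * x) \<in> ?I"
        by (intro ring.span_diff ring.span_scale less.prems(2) s)
      then have "x * (y * s) \<in> ?I" by (simp add: algebra_simps)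
      then have "y * s \<in> ?I" using x by (simp add: nonzerodivisor_mod_def)
      moreover have "s \<in> G (k - e)" unfolding s_def by (rule component_in)
      ultimately have "s \<in> ?I" using less.hyps[of "k - e" s] e False by simp
      then have "(r - s * x) + x * s \<in> ?I" by (intro ring.span_add s ring.span_scale)
      then show ?thesis by (simp add: mult.commute)
    qed
  qed
  show "nonzerodivisor_mod ?I y"
    unfolding nonzerodivisor_mod_def
  proof (intro allI impI)
    fix r assume "y * r \<in> ?I"
    then have "component (r * y) (k + m) \<in> ?I" for k
      using component_in_ideal[OF A] by (simp add: mult.commute)
    then have "y * component r k \<in> ?I" for k
      using component_mult[OF m, of r "k + m" for k] by (simp add: mult.commute)
    then have "component r k \<in> ?I" for k using homogeneous component_in by blast
    then have "(\<Sum>k | component r k \<noteq> 0. component r k) \<in> ?I" by (intro ring.span_sum)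
    then show "r \<in> ?I" by (subst sum_component)
  qed
qed

end

section \<open>Contractions of exterior and symmetric factors\<close>

abbreviation "lookup \<equiv> Poly_Mapping.lookup"
abbreviation "keys \<equiv> Poly_Mapping.keys"
abbreviation "single \<equiv> Poly_Mapping.single"

lemma fscale_single: "fscale c (single k r) = single k (c * r)"
  by (rule poly_mapping_eqI) (simp add: lookup_fscale lookup_single when_def)

lemma poly_mapping_expansion:
  assumes "finite K" "keys p \<subseteq> K"
  shows "p = (\<Sum>k\<in>K. fscale (lookup p k) (single k 1))"
proof (rule poly_mapping_eqI)
  fix j
  have "lookup (\<Sum>k\<in>K. fscale (lookup p k) (single k 1)) j = (\<Sum>k\<in>K. if k = j then lookup p k else 0)"
    by (simp add: lookup_sum fscale_single lookup_single when_def)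
  also have "\<dots> = lookup p j" using assms by (auto simp: sum.delta' in_keys_iff)
  finally show "lookup p j = lookup (\<Sum>k\<in>K. fscale (lookup p k) (single k 1)) j" ..
qed

lemma linear_extension_superset:
  assumes "module scale" "finite K" "keys p \<subseteq> K"
  shows "linear_extension scale g p = (\<Sum>k\<in>K. scale (lookup p k) (g k))"
proof -
  interpret module scale by fact
  show ?thesis unfolding linear_extension_def
    using assms(2,3) by (intro sum.mono_neutral_left) (auto simp: in_keys_iff)
qed

lemma module_hom_linear_extension:
  fixes scale :: "'r::comm_ring_1 \<Rightarrow> 'm::ab_group_add \<Rightarrow> 'm" and g :: "'k \<Rightarrow> 'm"
  assumes "module scale"
  shows "module_hom fscale scale (linear_extension scale g)"
proof -
  interpret module scale by fact
  show ?thesis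
  proof (intro module_hom.intro module_hom_axioms.intro module_fscale assms)
    fix p q :: "'k \<Rightarrow>\<^sub>0 'r" and r
    have K: "finite (keys p \<union> keys q)" by simp
    show "linear_extension scale g (p + q) = linear_extension scale g p + linear_extension scale g q"
      using keys_add[of p q]
      by (simp add: linear_extension_superset[OF assms K] lookup_add scale_left_distrib sum.distrib)
    have "keys (fscale r p) \<subseteq> keys p" by (auto simp: in_keys_iff lookup_fscale)
    then show "linear_extension scale g (fscale r p) = scale r (linear_extension scale g p)"
      by (simp add: linear_extension_superset[OF assms, of "keys p"] lookup_fscale scale_sum_right)
  qed
qed

lemma linear_extension_single:
  assumes "module scale"
  shows "linear_extension scale g (single k c) = scale c (g k)"
proof -
  interpret module scale by fact
  show ?thesis by (simp add: linear_extension_superset[OF assms, of "{k}"] lookup_single)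
qed

lemma module_hom_poly_mapping_eqI:
  assumes "module_hom fscale scale f" "module_hom fscale scale g"
    and "\<And>k. k \<in> keys p \<Longrightarrow> f (single k 1) = g (single k 1)"
  shows "f p = g p"
proof -
  let ?e = "\<Sum>k\<in>keys p. fscale (lookup p k) (single k 1)"
  have "f ?e = g ?e"
    by (simp add: module_hom.sum[OF assms(1)] module_hom.sum[OF assms(2)]
        module_hom.scale[OF assms(1)] module_hom.scale[OF assms(2)] assms(3))
  moreover have "?e = p" by (rule poly_mapping_expansion[symmetric]) simp_all
  ultimately show ?thesis by (simp only:)
qed

text \<open>The common shape of \<open>\<kappa>\<close> and \<open>Kos \<otimes> 1\<close>: the contraction \<open>f\<^sub>\<sigma> \<otimes> f\<^sup>\<alpha> \<mapsto> \<Sum>\<^sub>s \<plusminus> c s f\<^bsub>\<sigma> - s\<^esub> \<otimes> f\<^bsup>\<alpha> + m s\<^esup>\<close>.\<close>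

definition contract ::
  "(nat \<Rightarrow> nat \<Rightarrow>\<^sub>0 nat) \<Rightarrow> (nat \<Rightarrow> 'r::comm_ring_1) \<Rightarrow> (ext_sym_index \<Rightarrow>\<^sub>0 'r) \<Rightarrow> (ext_sym_index \<Rightarrow>\<^sub>0 'r)" where
  "contract m c = linear_extension fscale (\<lambda>(\<sigma>, \<alpha>). \<Sum>s\<in>\<sigma>.
     single (\<sigma> - {s}, \<alpha> + m s) (position_sign \<sigma> s * c s))"

lemma kappa_eq_contract: "kappa = contract (\<lambda>s. single s 1) (\<lambda>_. 1)"
  by (simp add: kappa_def contract_def)

lemma Kos_eq_contract: "Kos_tensor_1 x = contract (\<lambda>_. 0) x"
  by (simp add: Kos_tensor_1_def contract_def)

lemma module_hom_contract: "module_hom fscale fscale (contract m c)"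
  unfolding contract_def by (rule module_hom_linear_extension[OF module_fscale])

lemma module_hom_contract_contract:
  "module_hom fscale fscale (\<lambda>p. contract m c (contract m' c' p))"
  using module_hom_compose[OF module_hom_contract[of m' c'] module_hom_contract[of m c]]
  by (simp add: o_def)

lemma contract_single:
  "contract m c (single (\<sigma>, \<alpha>) r) =
     (\<Sum>s\<in>\<sigma>. single (\<sigma> - {s}, \<alpha> + m s) (r * (position_sign \<sigma> s * c s)))"
  unfolding contract_def linear_extension_single[OF module_fscale]
  by (simp add: free.scale_sum_right fscale_single)

lemma position_sign_insert_self: "position_sign (insert s \<tau>) s = position_sign \<tau> s"
  unfolding position_sign_def by (intro arg_cong[where f = "\<lambda>A. (-1) ^ card A"]) auto

lemma position_sign_square: "position_sign \<tau> s * position_sign \<tau> s = (1 :: 'r::comm_ring_1)"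
  unfolding position_sign_def by (simp add: power_add[symmetric])

text \<open>The contraction seen from its target: each \<open>s \<notin> \<tau>\<close> contributes
  from the one source with \<open>s\<close> put back. Subtraction of exponents is truncated, so the
  existence test discards those \<open>s\<close> for which there is no source.\<close>

lemma lookup_contract:
  assumes "finite N" and keys: "\<And>\<sigma> \<alpha>. (\<sigma>, \<alpha>) \<in> keys p \<Longrightarrow> \<sigma> \<subseteq> N"
  shows "lookup (contract m c p) (\<tau>, \<beta>) = (\<Sum>s\<in>N - \<tau>. position_sign \<tau> s * c s *
     (if \<exists>\<alpha>. \<beta> = \<alpha> + m s then lookup p (insert s \<tau>, \<beta> - m s) else 0))"
proof -
  let ?E = "\<lambda>s. \<exists>\<alpha>. \<beta> = \<alpha> + m s"
  let ?g = "\<lambda>(\<sigma>, \<alpha>). \<Sum>s\<in>\<sigma>. single (\<sigma> - {s}, \<alpha> + m s) (position_sign \<sigma> s * c s)"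
  let ?t = "\<lambda>k s. if k = (insert s \<tau>, \<beta> - m s) \<and> ?E s then position_sign \<tau> s * c s else 0"
  have g: "lookup (?g k) (\<tau>, \<beta>) = (\<Sum>s\<in>N - \<tau>. ?t k s)" if "k \<in> keys p" for k
  proof -
    obtain \<sigma> \<alpha> where k: "k = (\<sigma>, \<alpha>)" by (cases k)
    then have \<sigma>: "\<sigma> \<subseteq> N" using keys that by blast
    have iff: "s \<in> \<sigma> \<and> \<sigma> - {s} = \<tau> \<and> \<alpha> + m s = \<beta> \<longleftrightarrow> s \<notin> \<tau> \<and> k = (insert s \<tau>, \<beta> - m s) \<and> ?E s" for s
      unfolding k by auto
    have "lookup (?g k) (\<tau>, \<beta>) =
        (\<Sum>s\<in>\<sigma>. if \<sigma> - {s} = \<tau> \<and> \<alpha> + m s = \<beta> then position_sign \<sigma> s * c s else 0)"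
      by (simp add: k lookup_sum lookup_single when_def)
    also have "\<dots> = (\<Sum>s\<in>N. if s \<in> \<sigma> \<and> \<sigma> - {s} = \<tau> \<and> \<alpha> + m s = \<beta> then position_sign \<sigma> s * c s else 0)"
      using \<open>finite N\<close> \<sigma> by (intro sum.mono_neutral_cong_left) auto
    also have "\<dots> = (\<Sum>s\<in>N. if s \<notin> \<tau> \<and> k = (insert s \<tau>, \<beta> - m s) \<and> ?E s then position_sign \<tau> s * c s else 0)"
      unfolding iff by (intro sum.cong refl) (auto simp: k position_sign_insert_self)
    also have "\<dots> = (\<Sum>s\<in>N - \<tau>. ?t k s)"
      using \<open>finite N\<close> by (intro sum.mono_neutral_cong_right) auto
    finally show ?thesis .
  qed
  have "lookup (contract m c p) (\<tau>, \<beta>) = (\<Sum>k\<in>keys p. lookup p k * lookup (?g k) (\<tau>, \<beta>))"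
    by (simp add: contract_def linear_extension_def lookup_sum lookup_fscale)
  also have "\<dots> = (\<Sum>k\<in>keys p. \<Sum>s\<in>N - \<tau>. lookup p k * ?t k s)"
    by (intro sum.cong refl) (simp only: g sum_distrib_left)
  also have "\<dots> = (\<Sum>s\<in>N - \<tau>. \<Sum>k\<in>keys p. lookup p k * ?t k s)" by (rule sum.swap)
  also have "\<dots> = (\<Sum>s\<in>N - \<tau>. position_sign \<tau> s * c s *
     (if ?E s then lookup p (insert s \<tau>, \<beta> - m s) else 0))"
  proof (intro sum.cong refl)
    fix s
    have "(\<Sum>k\<in>keys p. lookup p k * ?t k s) = (\<Sum>k\<in>keys p. if k = (insert s \<tau>, \<beta> - m s)
        then (if ?E s then lookup p k * (position_sign \<tau> s * c s) else 0) else 0)"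
      by (intro sum.cong refl) auto
    also have "\<dots> = position_sign \<tau> s * c s * (if ?E s then lookup p (insert s \<tau>, \<beta> - m s) else 0)"
      by (auto simp: sum.delta in_keys_iff mult_ac)
    finally show "(\<Sum>k\<in>keys p. lookup p k * ?t k s) =
      position_sign \<tau> s * c s * (if ?E s then lookup p (insert s \<tau>, \<beta> - m s) else 0)" .
  qed
  finally show ?thesis .
qed

lemma position_sign_remove_less:
  assumes "finite \<sigma>" "s \<in> \<sigma>" "s < t"
  shows "position_sign (\<sigma> - {s}) t = (- position_sign \<sigma> t :: 'r::comm_ring_1)"
    and "position_sign (\<sigma> - {t}) s = (position_sign \<sigma> s :: 'r)"
proof -
  have "{u \<in> \<sigma>. u < t} = insert s {u \<in> \<sigma> - {s}. u < t}" using assms by auto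
  then have "card {u \<in> \<sigma>. u < t} = Suc (card {u \<in> \<sigma> - {s}. u < t})"
    using assms by (simp only: card_insert_disjoint) auto
  then show "position_sign (\<sigma> - {s}) t = (- position_sign \<sigma> t :: 'r)" by (simp add: position_sign_def)
  show "position_sign (\<sigma> - {t}) s = (position_sign \<sigma> s :: 'r)"
    unfolding position_sign_def using assms
    by (intro arg_cong[where f = "\<lambda>A. (-1) ^ card A"]) auto
qed

text \<open>Removing the smaller of the two moves the larger one by one place, while removing the
  larger leaves the smaller in place: exactly one sign flips.\<close>

lemma position_sign_remove_two:
  assumes "finite \<sigma>" "s \<in> \<sigma>" "t \<in> \<sigma>" "s \<noteq> t"
  shows "position_sign \<sigma> s * position_sign (\<sigma> - {s}) t =
     - (position_sign \<sigma> t * position_sign (\<sigma> - {t}) s :: 'r::comm_ring_1)"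
  using assms position_sign_remove_less[of \<sigma> s t, where ?'r = 'r]
    position_sign_remove_less[of \<sigma> t s, where ?'r = 'r]
  by (cases "s < t") (simp_all add: mult.commute)

text \<open>The double sum is spread over the full square with zero diagonal, so that the two
  summations can be interchanged.\<close>

lemma contract_contract_single:
  assumes "finite \<sigma>"
  shows "contract m c (contract m' c' (single (\<sigma>, \<alpha>) 1)) =
    (\<Sum>s\<in>\<sigma>. \<Sum>t\<in>\<sigma>. if s = t then 0 else single (\<sigma> - {s, t}, \<alpha> + m' s + m t)
       (position_sign \<sigma> s * position_sign (\<sigma> - {s}) t * (c' s * c t)))"
proof -
  have "contract m c (contract m' c' (single (\<sigma>, \<alpha>) 1)) =
    (\<Sum>s\<in>\<sigma>. \<Sum>t\<in>\<sigma> - {s}. single (\<sigma> - {s} - {t}, \<alpha> + m' s + m t)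
       (position_sign \<sigma> s * c' s * (position_sign (\<sigma> - {s}) t * c t)))"
    by (simp add: contract_single module_hom.sum[OF module_hom_contract])
  also have "\<dots> = (\<Sum>s\<in>\<sigma>. \<Sum>t\<in>\<sigma>. if s = t then 0 else single (\<sigma> - {s, t}, \<alpha> + m' s + m t)
       (position_sign \<sigma> s * position_sign (\<sigma> - {s}) t * (c' s * c t)))"
  proof (rule sum.cong[OF refl], rule sum.mono_neutral_cong_left)
    fix s t assume "t \<in> \<sigma> - {s}"
    moreover have "\<sigma> - {s} - {t} = \<sigma> - {s, t}" by auto
    ultimately show "single (\<sigma> - {s} - {t}, \<alpha> + m' s + m t)
        (position_sign \<sigma> s * c' s * (position_sign (\<sigma> - {s}) t * c t)) =
      (if s = t then 0 else single (\<sigma> - {s, t}, \<alpha> + m' s + m t)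
        (position_sign \<sigma> s * position_sign (\<sigma> - {s}) t * (c' s * c t)))"
      by (simp add: mult_ac)
  qed (use assms in auto)
  finally show ?thesis .
qed

text \<open>Off the diagonal the terms cancel in pairs. The diagonal is a separate assumption
  because antisymmetry yields only \<open>F s s + F s s = 0\<close>.\<close>

lemma sum_antisymmetric_zero:
  fixes F :: "'i \<Rightarrow> 'i \<Rightarrow> 'g::ab_group_add"
  assumes "finite A" and "\<And>s. s \<in> A \<Longrightarrow> F s s = 0"
    and "\<And>s t. s \<in> A \<Longrightarrow> t \<in> A \<Longrightarrow> F s t = - F t s"
  shows "(\<Sum>s\<in>A. \<Sum>t\<in>A. F s t) = 0"
  using assms
proof (induction A rule: finite_induct)
  case empty
  show ?case by (simp only: sum.empty)
next
  case (insert u A)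
  have neg: "(\<Sum>s\<in>A. F s u) = (\<Sum>s\<in>A. - F u s)"
    by (intro sum.cong refl insert.prems(2)) simp_all
  have zero: "(\<Sum>s\<in>A. \<Sum>t\<in>A. F s t) = 0"
  proof (rule insert.IH)
    show "F s s = 0" if "s \<in> A" for s using that by (intro insert.prems(1)) simp
    show "F s t = - F t s" if "s \<in> A" "t \<in> A" for s t using that by (intro insert.prems(2)) simp_all
  qed
  have "(\<Sum>s\<in>insert u A. \<Sum>t\<in>insert u A. F s t) =
     F u u + (\<Sum>t\<in>A. F u t) + ((\<Sum>s\<in>A. F s u) + (\<Sum>s\<in>A. \<Sum>t\<in>A. F s t))"
    using insert.hyps by (simp add: sum.distrib)
  also have "\<dots> = 0"
    unfolding neg zero using insert.prems(1)[of u] by (simp add: sum_negf)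
  finally show ?case .
qed

lemma contract_term_swap:
  fixes c c' :: "nat \<Rightarrow> 'r::comm_ring_1" and \<alpha> \<mu> \<nu> :: "nat \<Rightarrow>\<^sub>0 nat"
  assumes "finite \<sigma>" "s \<in> \<sigma>" "t \<in> \<sigma>"
  shows "(if s = t then 0 else single (\<sigma> - {s, t}, \<alpha> + \<mu> + \<nu>)
       (position_sign \<sigma> s * position_sign (\<sigma> - {s}) t * (c' s * c t))) =
     - (if t = s then 0 else single (\<sigma> - {t, s}, \<alpha> + \<nu> + \<mu>)
       (position_sign \<sigma> t * position_sign (\<sigma> - {t}) s * (c t * c' s)))"
proof (cases "s = t")
  case False
  have e: "\<sigma> - {s, t} = \<sigma> - {t, s}" "\<alpha> + \<mu> + \<nu> = \<alpha> + \<nu> + \<mu>" "c' s * c t = c t * c' s"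
    by (auto simp: ac_simps)
  show ?thesis
    unfolding e position_sign_remove_two[OF assms False] mult_minus_left single_uminus
    using False by simp
qed simp

text \<open>Meant for \<open>kappa\<close> against \<open>Kos_tensor_1\<close>. On a basis element,
  removing \<open>s\<close> before \<open>t\<close> and removing \<open>t\<close> before
  \<open>s\<close> give the same term with opposite signs.\<close>

lemma contract_anticommute: "contract m c (contract m' c' p) = - contract m' c' (contract m c p)"
proof (rule module_hom_poly_mapping_eqI[where f = "\<lambda>p. contract m c (contract m' c' p)"
      and g = "\<lambda>p. - contract m' c' (contract m c p)"])
  show "module_hom fscale fscale (\<lambda>p. contract m c (contract m' c' p))"
    by (rule module_hom_contract_contract)
  show "module_hom fscale fscale (\<lambda>p. - contract m' c' (contract m c p))"
    using module_hom_contract_contract[of m' c' m c] by (simp add: module_hom_iff free.scale_minus_right)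
  fix k :: ext_sym_index
  obtain \<sigma> \<alpha> where k: "k = (\<sigma>, \<alpha>)" by (cases k)
  show "contract m c (contract m' c' (single k 1)) = - contract m' c' (contract m c (single k 1))"
  \<comment> \<open>The index type admits infinite \<sigma>; sums over such a set are 0, so both
    sides vanish.\<close>
  proof (cases "finite \<sigma>")
    case True
    have "contract m c (contract m' c' (single k 1)) =
      (\<Sum>s\<in>\<sigma>. \<Sum>t\<in>\<sigma>. - (if t = s then 0 else single (\<sigma> - {t, s}, \<alpha> + m t + m' s)
         (position_sign \<sigma> t * position_sign (\<sigma> - {t}) s * (c t * c' s))))"
      unfolding k contract_contract_single[OF True]
      by (intro sum.cong refl contract_term_swap[OF True])
    also have "\<dots> = - contract m' c' (contract m c (single k 1))"
      unfolding k contract_contract_single[OF True] by (subst sum.swap) (simp add: sum_negf)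
    finally show ?thesis .
  qed (simp add: k contract_single module_hom.zero[OF module_hom_contract])
qed

text \<open>Anticommutation of the map with itself would only kill twice the square, so the terms
  are cancelled in pairs instead.\<close>

lemma contract_contract_same: "contract m c (contract m c p) = 0"
proof (rule module_hom_poly_mapping_eqI[where f = "\<lambda>p. contract m c (contract m c p)" and g = "\<lambda>_. 0"])
  show "module_hom fscale fscale (\<lambda>p. contract m c (contract m c p))"
    by (rule module_hom_contract_contract)
  show "module_hom fscale fscale (\<lambda>p. 0)" by (simp add: module_hom_iff module_fscale)
  fix k :: ext_sym_index
  obtain \<sigma> \<alpha> where k: "k = (\<sigma>, \<alpha>)" by (cases k)
  show "contract m c (contract m c (single k 1)) = 0"
  proof (cases "finite \<sigma>")
    case True
    show ?thesis
      unfolding k contract_contract_single[OF True]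
      by (rule sum_antisymmetric_zero[OF True]) (simp, rule contract_term_swap[OF True])
  qed (simp add: k contract_single module_hom.zero[OF module_hom_contract])
qed

section \<open>Coordinates of the modules \<open>L\<close>\<close>

lemma keys_fscale: "keys (fscale c p) \<subseteq> keys p"
proof
  fix k assume "k \<in> keys (fscale c p)"
  then have "c * lookup p k \<noteq> 0" unfolding in_keys_iff lookup_fscale .
  then have "lookup p k \<noteq> 0" by (metis mult_zero_right)
  then show "k \<in> keys p" unfolding in_keys_iff .
qed

lemma free_subspace_keys: "free.subspace {p :: 'k \<Rightarrow>\<^sub>0 'r::comm_ring_1. keys p \<subseteq> K}"
proof (rule free.subspaceI)
  fix p q :: "'k \<Rightarrow>\<^sub>0 'r" and c
  assume p: "p \<in> {p. keys p \<subseteq> K}"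
  then show "fscale c p \<in> {p. keys p \<subseteq> K}" using keys_fscale[of c p] by blast
  assume "q \<in> {p. keys p \<subseteq> K}"
  then show "p + q \<in> {p. keys p \<subseteq> K}" using p keys_add[of p q] by blast
next
  show "(0 :: 'k \<Rightarrow>\<^sub>0 'r) \<in> {p. keys p \<subseteq> K}" by simp
qed

lemma ext_sym_restricted_eq:
  "ext_sym_restricted n a b w = {p :: ext_sym_index \<Rightarrow>\<^sub>0 'r::comm_ring_1. keys p \<subseteq> ext_sym_indices n a b w}"
proof
  show "ext_sym_restricted n a b w \<subseteq> {p :: ext_sym_index \<Rightarrow>\<^sub>0 'r. keys p \<subseteq> ext_sym_indices n a b w}"
    unfolding ext_sym_restricted_def
    by (rule free.span_minimal[OF _ free_subspace_keys]) auto
next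
  show "{p :: ext_sym_index \<Rightarrow>\<^sub>0 'r. keys p \<subseteq> ext_sym_indices n a b w} \<subseteq> ext_sym_restricted n a b w"
  proof
    fix p :: "ext_sym_index \<Rightarrow>\<^sub>0 'r" assume "p \<in> {p. keys p \<subseteq> ext_sym_indices n a b w}"
    then have "(\<Sum>k\<in>keys p. fscale (lookup p k) (single k 1)) \<in> ext_sym_restricted n a b w"
      unfolding ext_sym_restricted_def
      by (intro free.span_sum free.span_scale free.span_base) auto
    then show "p \<in> ext_sym_restricted n a b w"
      by (subst poly_mapping_expansion[of "keys p" p]) simp_all
  qed
qed

lemma lookup_ext_sym_restricted:
  "p \<in> ext_sym_restricted n a b w \<Longrightarrow> k \<notin> ext_sym_indices n a b w \<Longrightarrow> lookup p k = 0"
  by (auto simp: ext_sym_restricted_eq in_keys_iff)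

lemma ext_sym_restricted_subspace: "free.subspace (ext_sym_restricted n a b w)"
  unfolding ext_sym_restricted_def by (rule free.subspace_span)

lemma finite_ext_sym_indices: "finite (ext_sym_indices n a b w)"
proof -
  let ?F = "{g :: nat \<Rightarrow> nat. \<forall>i. (i \<in> {1..n} \<longrightarrow> g i \<in> {..b}) \<and> (i \<notin> {1..n} \<longrightarrow> g i = 0)}"
  let ?A = "{\<alpha>. keys \<alpha> \<subseteq> {1..n} \<and> (\<Sum>i=1..n. lookup \<alpha> i) = b}"
  have "lookup ` ?A \<subseteq> ?F"
  proof clarify
    fix \<alpha> :: "nat \<Rightarrow>\<^sub>0 nat" and i
    assume \<alpha>: "keys \<alpha> \<subseteq> {1..n}" "b = (\<Sum>i=1..n. lookup \<alpha> i)"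
    show "(i \<in> {1..n} \<longrightarrow> lookup \<alpha> i \<in> {..\<Sum>i=1..n. lookup \<alpha> i}) \<and> (i \<notin> {1..n} \<longrightarrow> lookup \<alpha> i = 0)"
      using \<alpha> member_le_sum[of i "{1..n}" "lookup \<alpha>"] by (auto simp: in_keys_iff)
  qed
  moreover have "finite ?F" by (rule finite_set_of_finite_funs) auto
  ultimately have "finite (lookup ` ?A)" by (rule finite_subset)
  then have "finite ?A" by (rule finite_imageD) (rule inj_onI, simp only: lookup_inject)
  then have "finite (Pow {1..n} \<times> ?A)" by simp
  then show ?thesis by (rule finite_subset[rotated]) (auto simp: ext_sym_indices_def)
qed

section \<open>Index sets when a factor is removed or moved\<close>

lemma multidegree_move:
  assumes "s \<in> \<sigma>"
  shows "multidegree (\<sigma> - {s}, \<alpha> + single s 1) = multidegree (\<sigma>, \<alpha>)"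
  using assms by (auto simp: multidegree_def fun_eq_iff lookup_add lookup_single when_def)

lemma sum_lookup_add_single:
  fixes s n :: nat
  assumes "s \<in> {1..n}"
  shows "(\<Sum>i=1..n. lookup (\<alpha> + single s 1) i) = Suc (\<Sum>i=1..n. lookup \<alpha> i)"
proof -
  have "(\<Sum>i=1..n. lookup (single s (1 :: nat)) i) = (\<Sum>i\<in>{s}. 1)"
    using assms by (intro sum.mono_neutral_cong_right) (auto simp: lookup_single when_def)
  then show ?thesis by (simp add: lookup_add sum.distrib)
qed

lemma minus_single_add_single:
  "lookup \<beta> v > (0 :: nat) \<Longrightarrow> \<beta> - single v 1 + single v 1 = \<beta>"
  by (intro poly_mapping_eqI) (auto simp: lookup_add lookup_minus lookup_single when_def)

lemma ext_sym_indices_iff: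
  "(\<sigma>, \<alpha>) \<in> ext_sym_indices n a b w \<longleftrightarrow> \<sigma> \<subseteq> {1..n} \<and> card \<sigma> = a \<and> keys \<alpha> \<subseteq> {1..n} \<and>
     (\<Sum>i=1..n. lookup \<alpha> i) = b \<and> (\<forall>i\<in>{1..n}. multidegree (\<sigma>, \<alpha>) i \<le> w i)"
  by (simp add: ext_sym_indices_def)

lemma finite_ext_sym_index: "(\<sigma>, \<alpha>) \<in> ext_sym_indices n a b w \<Longrightarrow> finite \<sigma>"
  unfolding ext_sym_indices_iff using finite_subset by blast

lemma ext_sym_indices_remove:
  assumes "(\<sigma>, \<alpha>) \<in> ext_sym_indices n (Suc a) b w" "s \<in> \<sigma>"
  shows "(\<sigma> - {s}, \<alpha>) \<in> ext_sym_indices n a b w"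
proof -
  have "card (\<sigma> - {s}) = a"
    using assms finite_ext_sym_index[OF assms(1)] by (simp add: ext_sym_indices_iff)
  moreover have "multidegree (\<sigma> - {s}, \<alpha>) i \<le> multidegree (\<sigma>, \<alpha>) i" for i
    by (simp add: multidegree_def)
  ultimately show ?thesis
    using assms(1) unfolding ext_sym_indices_iff by (meson Diff_subset order_trans)
qed

lemma ext_sym_indices_move:
  assumes "(\<sigma>, \<alpha>) \<in> ext_sym_indices n (Suc a) b w" "s \<in> \<sigma>"
  shows "(\<sigma> - {s}, \<alpha> + single s 1) \<in> ext_sym_indices n a (Suc b) w"
proof -
  have s: "s \<in> {1..n}" using assms by (auto simp: ext_sym_indices_iff)
  have "card (\<sigma> - {s}) = a"
    using assms finite_ext_sym_index[OF assms(1)] by (simp add: ext_sym_indices_iff)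
  moreover have "keys (\<alpha> + single s 1) \<subseteq> {1..n}"
    using assms(1) s keys_add[of \<alpha> "single s 1"] by (auto simp: ext_sym_indices_iff)
  ultimately show ?thesis
    using assms(1)
    unfolding ext_sym_indices_iff multidegree_move[OF assms(2)] sum_lookup_add_single[OF s] by blast
qed

lemma multidegree_move_back:
  assumes "v \<notin> \<tau>" "lookup \<beta> v > 0"
  shows "multidegree (insert v \<tau>, \<beta> - single v 1) = multidegree (\<tau>, \<beta>)"
  using multidegree_move[of v "insert v \<tau>" "\<beta> - single v 1"] assms(1)
  unfolding minus_single_add_single[OF assms(2)] by simp

lemma ext_sym_indices_move_back:
  assumes "(\<tau>, \<beta>) \<in> ext_sym_indices n a (Suc b) w" "v \<notin> \<tau>" "lookup \<beta> v > 0"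
  shows "(insert v \<tau>, \<beta> - single v 1) \<in> ext_sym_indices n (Suc a) b w"
proof -
  have "v \<in> keys \<beta>" using assms(3) by (simp add: in_keys_iff)
  then have v: "v \<in> {1..n}" using assms(1) unfolding ext_sym_indices_iff by blast
  have "card (insert v \<tau>) = Suc a"
    using assms finite_ext_sym_index[OF assms(1)] by (simp add: ext_sym_indices_iff)
  moreover have "keys (\<beta> - single v 1) \<subseteq> keys \<beta>" by (auto simp: in_keys_iff lookup_minus)
  moreover have "Suc (\<Sum>i=1..n. lookup (\<beta> - single v 1) i) = (\<Sum>i=1..n. lookup \<beta> i)"
    using sum_lookup_add_single[OF v, of "\<beta> - single v 1"]
    unfolding minus_single_add_single[OF assms(3)] by simp
  ultimately show ?thesis
    using assms(1) v unfolding ext_sym_indices_iff multidegree_move_back[OF assms(2,3)]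
    by (auto simp del: One_nat_def)
qed

lemma contract_ext_sym_restricted:
  assumes "\<And>\<sigma> \<alpha> s. (\<sigma>, \<alpha>) \<in> ext_sym_indices n a b w \<Longrightarrow> s \<in> \<sigma> \<Longrightarrow>
      (\<sigma> - {s}, \<alpha> + m s) \<in> ext_sym_indices n a' b' w'"
    and "p \<in> ext_sym_restricted n a b w"
  shows "contract m c p \<in> ext_sym_restricted n a' b' w'"
proof -
  have "contract m c (\<Sum>k\<in>keys p. fscale (lookup p k) (single k 1)) \<in> ext_sym_restricted n a' b' w'"
    unfolding module_hom.sum[OF module_hom_contract] module_hom.scale[OF module_hom_contract]
  proof (intro free.subspace_sum free.subspace_scale ext_sym_restricted_subspace)
    fix k assume "k \<in> keys p"
    moreover obtain \<sigma> \<alpha> where k: "k = (\<sigma>, \<alpha>)" by (cases k)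
    ultimately have "(\<sigma>, \<alpha>) \<in> ext_sym_indices n a b w"
      using assms(2) by (auto simp: ext_sym_restricted_eq)
    then show "contract m c (single k 1) \<in> ext_sym_restricted n a' b' w'"
      unfolding k contract_single
      by (intro free.subspace_sum ext_sym_restricted_subspace)
        (auto simp: ext_sym_restricted_eq intro: assms(1))
  qed
  then show ?thesis using poly_mapping_expansion[of "keys p" p] by (simp only: finite_keys order_refl)
qed

lemma kappa_ext_sym_restricted:
  "p \<in> ext_sym_restricted n (Suc a) b w \<Longrightarrow> kappa p \<in> ext_sym_restricted n a (Suc b) w"
  unfolding kappa_eq_contract by (rule contract_ext_sym_restricted[OF ext_sym_indices_move])

lemma Kos_ext_sym_restricted:
  "p \<in> ext_sym_restricted n (Suc a) b w \<Longrightarrow> Kos_tensor_1 x p \<in> ext_sym_restricted n a b w"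
  unfolding Kos_eq_contract
  by (rule contract_ext_sym_restricted) (simp_all add: ext_sym_indices_remove)

lemma ext_sym_restricted_fst_subset:
  "p \<in> ext_sym_restricted n a b w \<Longrightarrow> (\<sigma>, \<alpha>) \<in> keys p \<Longrightarrow> \<sigma> \<subseteq> {1..n}"
  by (auto simp: ext_sym_restricted_eq ext_sym_indices_def)

lemma lookup_Kos:
  assumes "p \<in> ext_sym_restricted n a b w"
  shows "lookup (Kos_tensor_1 x p) (\<tau>, \<beta>) =
    (\<Sum>s\<in>{1..n} - \<tau>. position_sign \<tau> s * x s * lookup p (insert s \<tau>, \<beta>))"
  unfolding Kos_eq_contract
  by (subst lookup_contract[of "{1..n}"]) (use ext_sym_restricted_fst_subset[OF assms] in auto)

lemma add_single_iff: "(\<exists>\<alpha>. \<beta> = \<alpha> + single s 1) \<longleftrightarrow> lookup \<beta> s > (0 :: nat)"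
proof
  assume "lookup \<beta> s > 0"
  then have "\<beta> = (\<beta> - single s 1) + single s 1" by (rule minus_single_add_single[symmetric])
  then show "\<exists>\<alpha>. \<beta> = \<alpha> + single s 1" by blast
qed (auto simp: lookup_add)

lemma lookup_kappa:
  assumes "p \<in> ext_sym_restricted n a b w"
  shows "lookup (kappa p) (\<tau>, \<beta>) = (\<Sum>s\<in>{1..n} - \<tau>. position_sign \<tau> s *
    (if lookup \<beta> s > 0 then lookup p (insert s \<tau>, \<beta> - single s 1) else 0))"
proof -
  have "lookup (contract (\<lambda>s. single s 1) (\<lambda>_. 1) p) (\<tau>, \<beta>) = (\<Sum>s\<in>{1..n} - \<tau>. position_sign \<tau> s * 1 *
     (if \<exists>\<alpha>. \<beta> = \<alpha> + single s 1 then lookup p (insert s \<tau>, \<beta> - single s 1) else 0))"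
    by (rule lookup_contract[OF _ ext_sym_restricted_fst_subset[OF assms]]) simp_all
  then show ?thesis by (simp only: kappa_eq_contract add_single_iff mult_1_right)
qed

section \<open>The kernels of \<kappa> and their cone elements\<close>

lemma L_module_subspace: "free.subspace (L_module n a b w)"
proof -
  have "L_module n a b w = ext_sym_restricted n a b w \<inter> {p. kappa p = 0}"
    by (auto simp: L_module_def)
  moreover have "free.subspace {p. kappa p = 0}"
    unfolding kappa_eq_contract by (rule module_hom.subspace_kernel[OF module_hom_contract])
  ultimately show ?thesis using free.subspace_inter ext_sym_restricted_subspace by metis
qed

lemma kappa_zero_exterior_degree:
  assumes "p \<in> ext_sym_restricted n 0 b w"
  shows "kappa p = 0"
proof (rule poly_mapping_eqI)
  fix k :: ext_sym_index
  obtain \<tau> \<beta> where k: "k = (\<tau>, \<beta>)" by (cases k)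
  have zero: "lookup p (insert s \<tau>, \<alpha>) = 0" for s \<alpha>
    by (rule lookup_ext_sym_restricted[OF assms])
      (auto simp: ext_sym_indices_def card_eq_0_iff dest: finite_subset)
  then show "lookup (kappa p) k = lookup 0 k" 
    unfolding k lookup_kappa[OF assms] zero by simp
qed

lemma Kos_L_module:
  assumes "p \<in> L_module n (Suc a) b w"
  shows "Kos_tensor_1 x p \<in> L_module n a b w"
proof -
  have p: "p \<in> ext_sym_restricted n (Suc a) b w" "kappa p = 0" using assms by (auto simp: L_module_def)
  have "kappa (Kos_tensor_1 x p) = - Kos_tensor_1 x (kappa p)"
    unfolding kappa_eq_contract Kos_eq_contract by (rule contract_anticommute)
  also have "\<dots> = 0" unfolding p(2) Kos_eq_contract by (simp add: module_hom.zero[OF module_hom_contract])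
  finally show ?thesis using Kos_ext_sym_restricted[OF p(1)] by (simp add: L_module_def)
qed

text \<open>Read \<open>kappa p = 0\<close> at the index in which \<open>i\<close> has moved from
  \<tau> to the exponent. The term for \<open>s = i\<close> is the wanted coordinate up to sign, and
  \<open>zero\<close> disposes of all the others.\<close>

lemma L_module_coordinate_zero:
  assumes p: "p \<in> L_module n a b w" and i: "i \<in> \<tau>"
    and zero: "\<And>s \<beta>'. \<lbrakk>s \<in> {1..n}; s \<notin> \<tau>; \<beta>' = \<beta> + single i 1 - single s 1; lookup \<beta> s > 0\<rbrakk> \<Longrightarrow>
      lookup p (insert s (\<tau> - {i}), \<beta>') = 0"
  shows "lookup p (\<tau>, \<beta>) = 0"
proof (cases "i \<in> {1..n}")
  case True
  have p': "p \<in> ext_sym_restricted n a b w" "kappa p = 0" using p by (auto simp: L_module_def)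
  let ?\<tau> = "\<tau> - {i}" and ?\<beta> = "\<beta> + single i 1"
  let ?g = "\<lambda>s. position_sign ?\<tau> s *
    (if lookup ?\<beta> s > 0 then lookup p (insert s ?\<tau>, ?\<beta> - single s 1) else 0)"
  have "?g s = 0" if "s \<in> {1..n} - ?\<tau> - {i}" for s
    using that zero[of s] by (auto simp: lookup_add lookup_single when_def)
  then have "(\<Sum>s\<in>{1..n} - ?\<tau> - {i}. ?g s) = 0" by (intro sum.neutral) blast
  moreover have "(\<Sum>s\<in>{1..n} - ?\<tau>. ?g s) = ?g i + (\<Sum>s\<in>{1..n} - ?\<tau> - {i}. ?g s)"
    using True by (intro sum.remove) auto
  moreover have "?g i = position_sign ?\<tau> i * lookup p (\<tau>, \<beta>)"
    using i by (simp add: insert_absorb lookup_add)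
  moreover have "(\<Sum>s\<in>{1..n} - ?\<tau>. ?g s) = 0"
    using lookup_kappa[OF p'(1), of ?\<tau> ?\<beta>] p'(2) by simp
  ultimately have "position_sign ?\<tau> i * lookup p (\<tau>, \<beta>) = 0" by simp
  then have "position_sign ?\<tau> i * position_sign ?\<tau> i * lookup p (\<tau>, \<beta>) = 0" by (simp add: mult.assoc)
  then show ?thesis by (simp add: position_sign_square)
next
  case False
  then show ?thesis
    using p i by (intro lookup_ext_sym_restricted[of p n a b w]) (auto simp: L_module_def ext_sym_indices_def)
qed

text \<open>The element \<open>\<kappa>(f\<^sub>v \<and> f\<^sub>\<tau> \<otimes> f\<^bsup>\<beta> - v\<^esup>)\<close> of \<open>L\<close>, for \<open>v \<notin> \<tau>\<close>: its only term without \<open>f\<^sub>v\<close>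
  in the exterior factor is \<open>f\<^sub>\<tau> \<otimes> f\<^sup>\<beta>\<close>.\<close>

definition cone_element :: "nat \<Rightarrow> ext_sym_index \<Rightarrow> ext_sym_index \<Rightarrow>\<^sub>0 'r::comm_ring_1" where
  "cone_element v = (\<lambda>(\<tau>, \<beta>). kappa (single (insert v \<tau>, \<beta> - single v 1) (position_sign \<tau> v)))"

lemma cone_element_in_L_module:
  assumes "(\<tau>, \<beta>) \<in> ext_sym_indices n a (Suc b) w" "v \<notin> \<tau>" "lookup \<beta> v > 0"
  shows "cone_element v (\<tau>, \<beta>) \<in> L_module n a (Suc b) w"
proof -
  have "single (insert v \<tau>, \<beta> - single v 1) (position_sign \<tau> v) \<in> ext_sym_restricted n (Suc a) b w"
    using ext_sym_indices_move_back[OF assms] by (auto simp: ext_sym_restricted_eq)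
  then have "cone_element v (\<tau>, \<beta>) \<in> ext_sym_restricted n a (Suc b) w"
    unfolding cone_element_def prod.case by (rule kappa_ext_sym_restricted)
  then show ?thesis
    by (simp add: L_module_def cone_element_def kappa_eq_contract contract_contract_same)
qed

lemma cone_element_eq:
  assumes "(\<tau>, \<beta>) \<in> ext_sym_indices n a (Suc b) w" "v \<notin> \<tau>" "lookup \<beta> v > 0"
  shows "lookup (cone_element v (\<tau>, \<beta>)) k = (\<Sum>s\<in>insert v \<tau>.
     if k = (insert v \<tau> - {s}, \<beta> - single v 1 + single s 1)
     then position_sign \<tau> v * position_sign (insert v \<tau>) s else 0)"
  unfolding cone_element_def prod.case kappa_eq_contract contract_single
  by (auto simp: lookup_sum lookup_single when_def intro!: sum.cong)

lemma lookup_cone_element: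
  fixes k :: ext_sym_index
  assumes "(\<tau>, \<beta>) \<in> ext_sym_indices n a (Suc b) w" "v \<notin> \<tau>" "lookup \<beta> v > 0" "v \<notin> fst k"
  shows "lookup (cone_element v (\<tau>, \<beta>)) k = (if k = (\<tau>, \<beta>) then 1 else 0 :: 'r::comm_ring_1)"
proof -
  note fin = finite_ext_sym_index[OF assms(1)]
  note \<beta> = minus_single_add_single[OF assms(3)]
  have "lookup (cone_element v (\<tau>, \<beta>)) k = (\<Sum>s\<in>insert v \<tau>. if s = v
     then if k = (\<tau>, \<beta>) then 1 else 0 else (0 :: 'r))"
    unfolding cone_element_eq[OF assms(1-3)]
  proof (rule sum.cong[OF refl])
    fix s assume "s \<in> insert v \<tau>"
    show "(if k = (insert v \<tau> - {s}, \<beta> - single v 1 + single s 1)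
      then position_sign \<tau> v * position_sign (insert v \<tau>) s else 0) =
      (if s = v then if k = (\<tau>, \<beta>) then 1 else 0 else (0 :: 'r))"
    proof (cases "s = v")
      case True
      \<comment> \<open>Among the terms only \<open>s = v\<close> removes \<open>v\<close>; its sign
        is squared away by the coefficient \<open>position_sign \<tau> v\<close> built into
        \<open>cone_element\<close>.\<close>
      then show ?thesis
        using assms(2) unfolding True \<beta> position_sign_insert_self position_sign_square by simp
    qed (use assms(4) in auto)
  qed
  also have "\<dots> = (if k = (\<tau>, \<beta>) then 1 else 0)" using fin by simp
  finally show ?thesis .
qed

lemma multidegree_cone_element:
  assumes "(\<tau>, \<beta>) \<in> ext_sym_indices n a (Suc b) w" "v \<notin> \<tau>" "lookup \<beta> v > 0"
    and "lookup (cone_element v (\<tau>, \<beta>)) k \<noteq> (0 :: 'r::comm_ring_1)"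
  shows "multidegree k = multidegree (\<tau>, \<beta>)"
proof -
  have "\<exists>s\<in>insert v \<tau>. k = (insert v \<tau> - {s}, \<beta> - single v 1 + single s 1)"
  proof (rule ccontr)
    assume "\<not> ?thesis"
    then have "lookup (cone_element v (\<tau>, \<beta>)) k = (0 :: 'r)"
      unfolding cone_element_eq[OF assms(1-3)] by (intro sum.neutral) auto
    then show False using assms(4) by blast
  qed
  then have "multidegree k = multidegree (insert v \<tau>, \<beta> - single v 1)"
    using multidegree_move by blast
  also have "\<dots> = multidegree (\<tau>, \<beta>)"
    by (rule multidegree_move_back[OF assms(2,3)])
  finally show ?thesis .
qed

section \<open>A basis of \<open>L\<close>\<close>

text \<open>The apex of the cone depends on the multidegree only, so it is common to all indices
  that \<open>kappa\<close> relates.\<close>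

definition vertex :: "ext_sym_index \<Rightarrow> nat" where
  "vertex k = (LEAST i. multidegree k i > 0)"

definition cone_indices :: "nat \<Rightarrow> nat \<Rightarrow> nat \<Rightarrow> (nat \<Rightarrow> nat) \<Rightarrow> ext_sym_index set" where
  "cone_indices n a b w = {k \<in> ext_sym_indices n a b w. vertex k \<notin> fst k}"

definition L_basis :: "nat \<Rightarrow> nat \<Rightarrow> nat \<Rightarrow> (nat \<Rightarrow> nat) \<Rightarrow> (ext_sym_index \<Rightarrow>\<^sub>0 'r::comm_ring_1) set" where
  "L_basis n a b w = (\<lambda>k. cone_element (vertex k) k) ` cone_indices n a b w"

lemma vertex_cong: "multidegree k = multidegree k' \<Longrightarrow> vertex k = vertex k'"
  by (simp add: vertex_def)

text \<open>Symmetric degree \<open>Suc b\<close> makes the multidegree nonzero, so the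
  \<open>LEAST\<close> is attained; off \<tau> a positive entry must come from \<beta>.\<close>

lemma lookup_vertex_pos:
  assumes "(\<tau>, \<beta>) \<in> cone_indices n a (Suc b) w"
  shows "lookup \<beta> (vertex (\<tau>, \<beta>)) > 0"
proof -
  have "(\<Sum>i=1..n. lookup \<beta> i) \<noteq> 0"
    using assms unfolding cone_indices_def ext_sym_indices_def by auto
  then obtain i where "lookup \<beta> i \<noteq> 0" by (meson sum.neutral)
  then have "multidegree (\<tau>, \<beta>) i > 0" by (simp add: multidegree_def)
  then have "multidegree (\<tau>, \<beta>) (vertex (\<tau>, \<beta>)) > 0" unfolding vertex_def by (rule LeastI)
  moreover have "vertex (\<tau>, \<beta>) \<notin> \<tau>" using assms by (simp add: cone_indices_def)
  ultimately show ?thesis by (simp add: multidegree_def)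
qed

lemma cone_element_vertex_in_L_module:
  assumes "k \<in> cone_indices n a (Suc b) w"
  shows "cone_element (vertex k) k \<in> L_module n a (Suc b) w"
proof -
  obtain \<tau> \<beta> where k: "k = (\<tau>, \<beta>)" by (cases k)
  show ?thesis
    using assms lookup_vertex_pos[of \<tau> \<beta> n a b w] unfolding k
    by (intro cone_element_in_L_module) (simp_all add: cone_indices_def)
qed

text \<open>Within one multidegree the vertex is shared and the computation for a fixed apex
  applies; different multidegrees have disjoint supports. The resulting identity matrix yields
  independence and coordinates.\<close>

lemma lookup_cone_element_vertex:
  assumes k': "k' \<in> cone_indices n a (Suc b) w" and k: "vertex k \<notin> fst k"
  shows "lookup (cone_element (vertex k') k') k = (if k = k' then 1 else 0 :: 'r::comm_ring_1)"
proof -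
  obtain \<tau> \<beta> where eq: "k' = (\<tau>, \<beta>)" by (cases k')
  have c: "(\<tau>, \<beta>) \<in> ext_sym_indices n a (Suc b) w" "vertex (\<tau>, \<beta>) \<notin> \<tau>"
    using k' by (simp_all add: eq cone_indices_def)
  have pos: "lookup \<beta> (vertex (\<tau>, \<beta>)) > 0" using lookup_vertex_pos k' unfolding eq .
  show ?thesis
  proof (cases "multidegree k = multidegree (\<tau>, \<beta>)")
    case True
    then have "vertex (\<tau>, \<beta>) \<notin> fst k" using k vertex_cong by metis
    then show ?thesis unfolding eq by (rule lookup_cone_element[OF c pos])
  next
    case False
    then have "lookup (cone_element (vertex k') k') k = (0 :: 'r)"
      using multidegree_cone_element[OF c pos] unfolding eq by blast
    then show ?thesis using False eq by auto
  qed
qed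

lemma finite_cone_indices: "finite (cone_indices n a b w)"
  unfolding cone_indices_def using finite_ext_sym_indices by (rule finite_subset[rotated]) blast

text \<open>If the vertex lies in \<tau>, the relation \<open>kappa q = 0\<close> expresses the
  coordinate through others of the same multidegree, hence with the same vertex, whose exterior part
  avoids it.\<close>

lemma L_module_eq_zero:
  assumes q: "q \<in> L_module n a b w" and zero: "\<And>k. k \<in> cone_indices n a b w \<Longrightarrow> lookup q k = 0"
  shows "q = 0"
proof (rule poly_mapping_eqI)
  have q': "q \<in> ext_sym_restricted n a b w" using q by (simp add: L_module_def)
  have free: "lookup q k = 0" if "vertex k \<notin> fst k" for k
    using that zero[of k] lookup_ext_sym_restricted[OF q', of k] by (auto simp: cone_indices_def)
  fix k :: ext_sym_index
  obtain \<tau> \<beta> where k: "k = (\<tau>, \<beta>)" by (cases k)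
  define i where "i = vertex k"
  have "lookup q k = 0"
  proof (cases "i \<in> \<tau>")
    case False
    then show ?thesis using free by (simp add: k i_def)
  next
    case True
    have "lookup q (\<tau>, \<beta>) = 0"
    proof (rule L_module_coordinate_zero[OF q True])
      fix s \<beta>' assume s: "s \<notin> \<tau>" "\<beta>' = \<beta> + single i 1 - single s 1" "lookup \<beta> s > 0"
      have "lookup (\<beta> + single i 1) s > 0" using s(3) by (simp add: lookup_add)
      then have "multidegree (insert s (\<tau> - {i}), \<beta>') = multidegree (\<tau> - {i}, \<beta> + single i 1)"
        unfolding s(2) by (intro multidegree_move_back) (use s(1) in auto)
      also have "\<dots> = multidegree k" unfolding k by (rule multidegree_move[OF True])
      finally have "vertex (insert s (\<tau> - {i}), \<beta>') = i" unfolding i_def by (rule vertex_cong)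
      moreover have "i \<notin> insert s (\<tau> - {i})" using s(1) True by auto
      ultimately show "lookup q (insert s (\<tau> - {i}), \<beta>') = 0" by (intro free) simp
    qed
    then show ?thesis by (simp add: k)
  qed
  then show "lookup q k = lookup 0 k" by simp
qed

lemma L_module_expansion:
  assumes p: "p \<in> L_module n a (Suc b) w"
  shows "p = (\<Sum>k\<in>cone_indices n a (Suc b) w. fscale (lookup p k) (cone_element (vertex k) k))"
    (is "p = ?s")
proof -
  let ?K = "cone_indices n a (Suc b) w"
  have "p - ?s \<in> L_module n a (Suc b) w"
    by (intro free.subspace_diff free.subspace_sum free.subspace_scale L_module_subspace p
        cone_element_vertex_in_L_module)
  moreover have "lookup (p - ?s) k = 0" if k: "k \<in> ?K" for k
  proof -
    have vk: "vertex k \<notin> fst k" using k by (simp add: cone_indices_def)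
    have "lookup ?s k = (\<Sum>k'\<in>?K. if k = k' then lookup p k' else 0)"
      unfolding lookup_sum lookup_fscale
      by (intro sum.cong refl) (simp add: lookup_cone_element_vertex[OF _ vk])
    also have "\<dots> = lookup p k" using k finite_cone_indices by simp
    finally show ?thesis by (simp add: lookup_minus)
  qed
  ultimately have "p - ?s = 0" by (rule L_module_eq_zero)
  then show ?thesis by (simp only: right_minus_eq)
qed

lemma basis_of_L_module: "basis_of fscale (L_basis n a (Suc b) w) (L_module n a (Suc b) w)"
proof -
  let ?K = "cone_indices n a (Suc b) w" and ?c = "\<lambda>k. cone_element (vertex k) k"
  have "\<not> free.dependent (L_basis n a (Suc b) w :: (ext_sym_index \<Rightarrow>\<^sub>0 'a) set)"
    unfolding free.dependent_explicit
  proof clarify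
    fix t u v
    assume t: "finite t" "t \<subseteq> L_basis n a (Suc b) w" and zero: "(\<Sum>v\<in>t. fscale (u v) v) = 0"
      and v: "v \<in> t" "u v \<noteq> (0 :: 'a)"
    obtain k where k: "k \<in> ?K" "v = ?c k" using t v unfolding L_basis_def by blast
    then have vk: "vertex k \<notin> fst k" by (simp add: cone_indices_def)
    \<comment> \<open>Read at the coordinate \<open>k\<close> belonging to \<open>v\<close>, the
      relation keeps only the term of \<open>v\<close>.\<close>
    have "u y * lookup y k = (if y = v then u v else 0)" if y: "y \<in> t" for y
    proof -
      obtain k' where k': "k' \<in> ?K" "y = ?c k'" using t y unfolding L_basis_def by blast
      show ?thesis
        using lookup_cone_element_vertex[OF k'(1) vk, where ?'r = 'a]
          lookup_cone_element_vertex[OF k(1) vk, where ?'r = 'a] k(2) k'(2) by (cases "y = v") auto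
    qed
    then have "lookup (\<Sum>v\<in>t. fscale (u v) v) k = (\<Sum>y\<in>t. if y = v then u v else 0)"
      unfolding lookup_sum lookup_fscale by (intro sum.cong refl)
    also have "\<dots> = u v" using t v by simp
    finally show False using zero v by simp
  qed
  moreover have "free.span (L_basis n a (Suc b) w) = (L_module n a (Suc b) w :: (ext_sym_index \<Rightarrow>\<^sub>0 'a) set)"
  proof
    show "free.span (L_basis n a (Suc b) w) \<subseteq> (L_module n a (Suc b) w :: (ext_sym_index \<Rightarrow>\<^sub>0 'a) set)"
      by (rule free.span_minimal[OF _ L_module_subspace])
        (auto simp: L_basis_def cone_element_vertex_in_L_module)
    show "L_module n a (Suc b) w \<subseteq> (free.span (L_basis n a (Suc b) w) :: (ext_sym_index \<Rightarrow>\<^sub>0 'a) set)"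
    proof
      fix p :: "ext_sym_index \<Rightarrow>\<^sub>0 'a" assume p: "p \<in> L_module n a (Suc b) w"
      have "(\<Sum>k\<in>?K. fscale (lookup p k) (?c k)) \<in> free.span (L_basis n a (Suc b) w)"
        by (intro free.span_sum free.span_scale free.span_base) (simp add: L_basis_def)
      then show "p \<in> free.span (L_basis n a (Suc b) w)" using L_module_expansion[OF p] by (simp only:)
    qed
  qed
  ultimately show ?thesis unfolding basis_of_def ..
qed

text \<open>Minimality concerns every basis. Expanding \<open>y\<close> in cone elements has
  coefficients \<open>lookup y k\<close> in \<open>J\<close>, and passing to the basis
  \<open>B\<close> is linear.\<close>

lemma representation_in_ideal:
  assumes J: "is_ideal J" and B: "basis_of fscale B (L_module n a (Suc b) w)"
    and y: "y \<in> L_module n a (Suc b) w" and coeff: "\<And>k. lookup y k \<in> J"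
  shows "free.representation B y v \<in> J"
proof -
  let ?K = "cone_indices n a (Suc b) w" and ?c = "\<lambda>k. cone_element (vertex k) k"
  have ind: "\<not> free.dependent B" and span: "free.span B = L_module n a (Suc b) w"
    using B by (auto simp: basis_of_def)
  have c: "?c k \<in> free.span B" if "k \<in> ?K" for k
    unfolding span by (rule cone_element_vertex_in_L_module[OF that])
  have "free.representation B (\<Sum>k\<in>?K. fscale (lookup y k) (?c k)) =
      (\<lambda>v. \<Sum>k\<in>?K. free.representation B (fscale (lookup y k) (?c k)) v)"
    by (rule free.representation_sum[OF ind]) (intro free.span_scale c)
  then have "free.representation B y v = (\<Sum>k\<in>?K. free.representation B (fscale (lookup y k) (?c k)) v)"
    using L_module_expansion[OF y] by (simp only:)
  also have "\<dots> = (\<Sum>k\<in>?K. free.representation B (?c k) v * lookup y k)"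
    by (intro sum.cong refl) (simp add: free.representation_scale[OF ind c] mult.commute)
  also have "\<dots> \<in> J" by (intro ring.subspace_sum[OF J] ring.subspace_scale[OF J] coeff)
  finally show ?thesis .
qed

lemma lookup_Kos_in_ideal:
  assumes "is_ideal J" "\<And>i. i \<in> {1..n} \<Longrightarrow> x i \<in> J" "p \<in> ext_sym_restricted n a b w"
  shows "lookup (Kos_tensor_1 x p) k \<in> J"
proof -
  obtain \<tau> \<beta> where k: "k = (\<tau>, \<beta>)" by (cases k)
  have "(position_sign \<tau> s * lookup p (insert s \<tau>, \<beta>)) * x s \<in> J" if "s \<in> {1..n} - \<tau>" for s
    using that assms(2) by (intro ring.subspace_scale[OF assms(1)]) simp
  then have "position_sign \<tau> s * x s * lookup p (insert s \<tau>, \<beta>) \<in> J" if "s \<in> {1..n} - \<tau>" for s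
    using that by (simp only: mult_ac)
  then show ?thesis unfolding k lookup_Kos[OF assms(3)] by (intro ring.subspace_sum[OF assms(1)])
qed

section \<open>Evaluation of symmetric powers in the ring\<close>

lemma module_hom_sym_eval: "module_hom fscale (*) (sym_eval n x)"
  unfolding sym_eval_def by (rule module_hom_linear_extension[OF module_ring_self])

lemma sym_eval_single: "sym_eval n x (single (\<sigma>, \<alpha>) c) = c * (\<Prod>i=1..n. x i ^ lookup \<alpha> i)"
  unfolding sym_eval_def linear_extension_single[OF module_ring_self] by simp

lemma prod_power_add_single:
  fixes s n :: nat
  assumes "s \<in> {1..n}"
  shows "(\<Prod>i=1..n. x i ^ lookup (\<alpha> + single s 1) i) = (x s :: 'r::comm_ring_1) * (\<Prod>i=1..n. x i ^ lookup \<alpha> i)"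
proof -
  have "(\<Prod>i=1..n. x i ^ lookup (single s (1 :: nat)) i) = (\<Prod>i\<in>{s}. x i)"
    using assms by (intro prod.mono_neutral_cong_right) (auto simp: lookup_single when_def)
  then show ?thesis by (simp add: lookup_add power_add prod.distrib mult.commute)
qed

text \<open>Both \<open>\<psi> \<circ> (Kos \<otimes> 1)\<close> and \<open>\<psi> \<circ> \<kappa>\<close> send \<open>f\<^sub>\<sigma> \<otimes> f\<^sup>\<alpha>\<close> to \<open>\<Sum>\<^sub>s \<plusminus> x s x\<^sup>\<alpha>\<close>.\<close>

lemma sym_eval_Kos_eq_kappa:
  assumes "p \<in> ext_sym_restricted n a b w"
  shows "sym_eval n x (Kos_tensor_1 x p) = sym_eval n x (kappa p)"
proof -
  have hom: "module_hom fscale (*) (\<lambda>p. sym_eval n x (contract m c p))" for m c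
    using module_hom_compose[OF module_hom_contract module_hom_sym_eval] by (simp add: o_def)
  show ?thesis
    unfolding Kos_eq_contract kappa_eq_contract
  proof (rule module_hom_poly_mapping_eqI[OF hom hom])
    fix k assume k: "k \<in> keys p"
    obtain \<sigma> \<alpha> where eq: "k = (\<sigma>, \<alpha>)" by (cases k)
    then have \<sigma>: "\<sigma> \<subseteq> {1..n}" using ext_sym_restricted_fst_subset[OF assms] k by blast
    show "sym_eval n x (contract (\<lambda>_. 0) x (single k 1)) =
      sym_eval n x (contract (\<lambda>s. single s 1) (\<lambda>_. 1) (single k 1))"
      unfolding eq contract_single module_hom.sum[OF module_hom_sym_eval] sym_eval_single
    proof (rule sum.cong[OF refl])
      fix s assume "s \<in> \<sigma>"
      then have "s \<in> {1..n}" using \<sigma> by blast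
      then show "1 * (position_sign \<sigma> s * x s) * (\<Prod>i=1..n. x i ^ lookup (\<alpha> + 0) i) =
          1 * (position_sign \<sigma> s * 1) * (\<Prod>i=1..n. x i ^ lookup (\<alpha> + single s 1) i)"
        unfolding prod_power_add_single[OF \<open>s \<in> {1..n}\<close>] by (simp add: mult_ac)
    qed
  qed
qed

lemma sym_eval_Kos_L_module:
  assumes "p \<in> L_module n a b w"
  shows "sym_eval n x (Kos_tensor_1 x p) = 0"
  using assms sym_eval_Kos_eq_kappa[of p n a b w x] module_hom.zero[OF module_hom_sym_eval]
  by (simp add: L_module_def)

lemma ext_sym_indices_insert:
  assumes "(\<tau>, \<beta>) \<in> ext_sym_indices n a b w" "s \<in> {1..n} - \<tau>" "lookup \<beta> s < w s"
  shows "(insert s \<tau>, \<beta>) \<in> ext_sym_indices n (Suc a) b w"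
proof -
  have "card (insert s \<tau>) = Suc a"
    using assms finite_ext_sym_index[OF assms(1)] by (simp add: ext_sym_indices_iff)
  moreover have "multidegree (insert s \<tau>, \<beta>) i \<le> w i" if "i \<in> {1..n}" for i
    using assms that unfolding ext_sym_indices_iff by (cases "i = s") (auto simp: multidegree_def)
  ultimately show ?thesis using assms(1,2) unfolding ext_sym_indices_iff by blast
qed

lemma ext_sym_indices_less:
  assumes "(\<tau>, \<beta>) \<in> ext_sym_indices n a b w" "s \<in> \<tau>"
  shows "s \<in> {1..n}" "lookup \<beta> s < w s"
proof -
  show s: "s \<in> {1..n}" using assms unfolding ext_sym_indices_iff by blast
  then have "multidegree (\<tau>, \<beta>) s \<le> w s" using assms unfolding ext_sym_indices_iff by blast
  then show "lookup \<beta> s < w s" using assms(2) by (simp add: multidegree_def)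
qed

section \<open>Exactness\<close>

text \<open>For an exponent \<beta> bounded by \<open>w\<close>, the subsets of this set are the
  exterior parts that keep the multidegree below \<open>w\<close>. The coordinates with this \<beta>
  thus form a Koszul complex on the slack variables.\<close>

abbreviation slack :: "nat \<Rightarrow> (nat \<Rightarrow> nat) \<Rightarrow> (nat \<Rightarrow>\<^sub>0 nat) \<Rightarrow> nat set" where
  "slack n w \<beta> \<equiv> {s \<in> {1..n}. lookup \<beta> s < w s}"

text \<open>In exterior degree 0 the condition on \<open>p\<close> is a relation between distinct
  monomials of degree \<open>d\<close> below \<open>w\<close>, to which
  \<open>restricted_relation_coefficient\<close> applies.\<close>

lemma coordinate_in_slack_ideal:
  assumes x: "subset_regular x {1..n}" and p: "p \<in> L_module n 0 d w" and "sym_eval n x p = 0"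
  shows "lookup p ({}, \<beta>) \<in> ideal_gen (x ` slack n w \<beta>)"
proof (cases "({}, \<beta>) \<in> ext_sym_indices n 0 d w")
  case False
  then have "lookup p ({}, \<beta>) = 0"
    using p lookup_ext_sym_restricted by (auto simp: L_module_def)
  then show ?thesis by (simp only: ring.span_zero)
next
  case True
  define A where "A = {\<beta>. ({}, \<beta>) \<in> ext_sym_indices n 0 d w}"
  have "(\<lambda>\<beta>. ({}, \<beta>)) ` A \<subseteq> ext_sym_indices n 0 d w" by (auto simp: A_def)
  then have "finite ((\<lambda>\<beta>. ({} :: nat set, \<beta>)) ` A)" using finite_ext_sym_indices by (rule finite_subset)
  then have fin: "finite A" by (rule finite_imageD) (simp add: inj_on_def)
  have keys: "keys p \<subseteq> (\<lambda>\<beta>. ({}, \<beta>)) ` A"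
  proof
    fix k assume k: "k \<in> keys p"
    obtain \<sigma> \<alpha> where eq: "k = (\<sigma>, \<alpha>)" by (cases k)
    have idx: "(\<sigma>, \<alpha>) \<in> ext_sym_indices n 0 d w"
      using p k unfolding eq L_module_def ext_sym_restricted_eq by blast
    then have "\<sigma> = {}" using finite_ext_sym_index[OF idx] by (simp add: ext_sym_indices_iff)
    then show "k \<in> (\<lambda>\<beta>. ({}, \<beta>)) ` A" using idx by (simp add: eq A_def)
  qed
  have "sym_eval n x p = (\<Sum>\<gamma>\<in>A. lookup p ({}, \<gamma>) * (\<Prod>s\<in>{1..n}. x s ^ lookup \<gamma> s))"
    unfolding sym_eval_def linear_extension_superset[OF module_ring_self finite_imageI[OF fin] keys]
    by (subst sum.reindex) (simp_all add: inj_on_def)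
  then have rel: "(\<Sum>\<gamma>\<in>A. lookup p ({}, \<gamma>) * (\<Prod>s\<in>{1..n}. x s ^ lookup \<gamma> s)) = 0"
    using assms(3) by simp
  show ?thesis
  proof (rule restricted_relation_coefficient[OF x _ fin _ _ _ _ rel])
    show "\<beta> \<in> A" using True by (simp add: A_def)
    show "lookup \<gamma> s \<le> w s" if "\<gamma> \<in> A" "s \<in> {1..n}" for \<gamma> s
    proof -
      have "multidegree ({}, \<gamma>) s \<le> w s" using that unfolding A_def mem_Collect_eq ext_sym_indices_iff by blast
      then show ?thesis by (simp add: multidegree_def)
    qed
    show "(\<Sum>s\<in>{1..n}. lookup \<gamma> s) = d" if "\<gamma> \<in> A" for \<gamma>
      using that unfolding A_def mem_Collect_eq ext_sym_indices_iff by blast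
    show "\<exists>s\<in>{1..n}. lookup \<gamma> s \<noteq> lookup \<beta> s" if "\<gamma> \<in> A" "\<gamma> \<noteq> \<beta>" for \<gamma>
    proof -
      have "lookup \<gamma> \<noteq> lookup \<beta>" using that(2) lookup_inject by metis
      then obtain s where s: "lookup \<gamma> s \<noteq> lookup \<beta> s" by blast
      then have "s \<in> keys \<gamma> \<union> keys \<beta>" by (metis UnI1 UnI2 in_keys_iff)
      then have "s \<in> {1..n}"
        using that(1) True unfolding A_def mem_Collect_eq ext_sym_indices_iff by blast
      then show ?thesis using s by blast
    qed
  qed simp
qed

text \<open>For fixed \<beta> the coordinates of a cycle form a Koszul cycle on the slack variables,
  hence a boundary; in exterior degree 0 the slack ideal takes the place of the cycle
  condition.\<close>

lemma coordinate_koszul_boundary: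
  assumes x: "subset_regular x {1..n}" and p: "p \<in> L_module n a d w"
    and cycle: "if a = 0 then sym_eval n x p = 0 else Kos_tensor_1 x p = 0"
  shows "\<exists>g. \<forall>\<tau>\<subseteq>slack n w \<beta>. card \<tau> = a \<longrightarrow> lookup p (\<tau>, \<beta>) = koszul x (slack n w \<beta>) g \<tau>"
proof (cases a)
  case 0
  then have "lookup p ({}, \<beta>) \<in> ideal_gen (x ` slack n w \<beta>)"
    using coordinate_in_slack_ideal[OF x, of p d w] p cycle by simp
  then obtain g where g: "lookup p ({}, \<beta>) = koszul x (slack n w \<beta>) g {}"
    using ideal_gen_eq_koszul[of "slack n w \<beta>"] by auto
  have "\<tau> = {}" if "\<tau> \<subseteq> slack n w \<beta>" "card \<tau> = a" for \<tau>
    using that 0 finite_subset[OF that(1)] by simp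
  then show ?thesis using g by blast
next
  case (Suc b)
  have p': "p \<in> ext_sym_restricted n (Suc b) d w" using p Suc by (simp add: L_module_def)
  have "koszul x (slack n w \<beta>) (\<lambda>\<tau>. lookup p (\<tau>, \<beta>)) \<tau> = 0" for \<tau>
  proof -
    have "koszul x (slack n w \<beta>) (\<lambda>\<tau>. lookup p (\<tau>, \<beta>)) \<tau> =
        (\<Sum>s\<in>{1..n} - \<tau>. position_sign \<tau> s * x s * lookup p (insert s \<tau>, \<beta>))"
      unfolding koszul_def
    proof (rule sum.mono_neutral_left)
      \<comment> \<open>An exterior factor at \<open>s\<close> uses one unit of \<open>w s\<close>,
        so outside the slack set there is no room for it.\<close>
      show "\<forall>s\<in>({1..n} - \<tau>) - (slack n w \<beta> - \<tau>). position_sign \<tau> s * x s * lookup p (insert s \<tau>, \<beta>) = 0"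
      proof
        fix s assume "s \<in> ({1..n} - \<tau>) - (slack n w \<beta> - \<tau>)"
        then have "(insert s \<tau>, \<beta>) \<notin> ext_sym_indices n (Suc b) d w"
          using ext_sym_indices_less(2)[of "insert s \<tau>" \<beta> n "Suc b" d w s] by auto
        then have "lookup p (insert s \<tau>, \<beta>) = 0" by (rule lookup_ext_sym_restricted[OF p'])
        then show "position_sign \<tau> s * x s * lookup p (insert s \<tau>, \<beta>) = 0" by (simp only: mult_zero_right)
      qed
    qed auto
    also have "\<dots> = lookup (Kos_tensor_1 x p) (\<tau>, \<beta>)" by (rule lookup_Kos[OF p', symmetric])
    finally show ?thesis using cycle Suc by simp
  qed
  then show ?thesis
    unfolding Suc by (intro koszul_exact[OF x finite_atLeastAtMost]) blast+
qed

text \<open>If \<open>lookup \<beta> i = w i\<close>, there is no room for \<open>i\<close> in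
  \<tau>. So all these indices are free coordinates for the apex \<open>i\<close>, and a combination
  of cone elements over \<open>i\<close> takes the prescribed values.\<close>

lemma L_module_lift:
  fixes G :: "(nat \<Rightarrow>\<^sub>0 nat) \<Rightarrow> nat set \<Rightarrow> 'r::comm_ring_1"
  assumes i: "i \<in> {1..n}" "w i > 0"
  shows "\<exists>p\<in>L_module n a (Suc b) w. \<forall>\<tau> \<beta>. (\<tau>, \<beta>) \<in> ext_sym_indices n a (Suc b) w \<longrightarrow>
     lookup \<beta> i = w i \<longrightarrow> lookup p (\<tau>, \<beta>) = G \<beta> \<tau>"
proof -
  define K where "K = {k \<in> ext_sym_indices n a (Suc b) w. lookup (snd k) i = w i}"
  define p where "p = (\<Sum>k\<in>K. fscale (G (snd k) (fst k)) (cone_element i k))"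
  have fin: "finite K" unfolding K_def using finite_ext_sym_indices by (rule finite_subset[rotated]) blast
  have K: "(\<tau>, \<beta>) \<in> ext_sym_indices n a (Suc b) w" "i \<notin> \<tau>" "lookup \<beta> i > 0"
    if k: "(\<tau>, \<beta>) \<in> K" for \<tau> \<beta>
  proof -
    show idx: "(\<tau>, \<beta>) \<in> ext_sym_indices n a (Suc b) w" and "lookup \<beta> i > 0"
      using k i(2) by (simp_all add: K_def)
    show "i \<notin> \<tau>" using ext_sym_indices_less(2)[OF idx, of i] k by (auto simp: K_def)
  qed
  have "p \<in> L_module n a (Suc b) w"
    unfolding p_def
  proof (intro free.subspace_sum free.subspace_scale L_module_subspace)
    fix k assume "k \<in> K"
    then show "cone_element i k \<in> L_module n a (Suc b) w"
      using cone_element_in_L_module[OF K] by (cases k) blast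
  qed
  moreover have "lookup p (\<tau>, \<beta>) = G \<beta> \<tau>"
    if "(\<tau>, \<beta>) \<in> ext_sym_indices n a (Suc b) w" "lookup \<beta> i = w i" for \<tau> \<beta>
  proof -
    have k: "(\<tau>, \<beta>) \<in> K" using that by (simp add: K_def)
    have "lookup p (\<tau>, \<beta>) = (\<Sum>k\<in>K. if (\<tau>, \<beta>) = k then G \<beta> \<tau> else 0)"
      unfolding p_def lookup_sum lookup_fscale
    proof (rule sum.cong[OF refl])
      fix k assume k': "k \<in> K"
      obtain \<tau>' \<beta>' where eq: "k = (\<tau>', \<beta>')" by (cases k)
      have "lookup (cone_element i k) (\<tau>, \<beta>) = (if (\<tau>, \<beta>) = k then 1 else 0 :: 'r)"
        unfolding eq by (rule lookup_cone_element[OF K[OF k'[unfolded eq]]]) (simp add: K(2)[OF k])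
      then show "G (snd k) (fst k) * lookup (cone_element i k) (\<tau>, \<beta>) =
          (if (\<tau>, \<beta>) = k then G \<beta> \<tau> else 0)" by auto
    qed
    also have "\<dots> = G \<beta> \<tau>" using fin k by simp
    finally show ?thesis .
  qed
  ultimately show ?thesis by blast
qed

lemma ext_sym_indices_mono:
  assumes "\<And>i. v i \<le> w i"
  shows "ext_sym_indices n a b v \<subseteq> ext_sym_indices n a b w"
  using assms unfolding ext_sym_indices_def by (auto intro: order_trans)

lemma L_module_mono:
  assumes "\<And>i. v i \<le> w i"
  shows "L_module n a b v \<subseteq> L_module n a b w"
  using ext_sym_indices_mono[of v w n a b, OF assms] unfolding L_module_def ext_sym_restricted_eq by blast

text \<open>An index of degree \<open>w i\<close> at \<open>i\<close> either has
  \<open>lookup \<beta> i = w i\<close>, or has \<open>i \<in> \<tau>\<close> and exponent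
  \<open>w i - 1\<close>. In the second case the \<kappa>-relation at \<open>i\<close> reduces it to
  indices of the first kind.\<close>

lemma L_module_decrease:
  assumes r: "r \<in> L_module n a b w" and i: "i \<in> {1..n}" "w i > 0"
    and zero: "\<And>\<tau> \<beta>. lookup \<beta> i = w i \<Longrightarrow> lookup r (\<tau>, \<beta>) = 0"
  shows "r \<in> L_module n a b (w(i := w i - 1))"
proof -
  have "k \<in> ext_sym_indices n a b (w(i := w i - 1))" if k: "k \<in> keys r" for k
  proof -
    obtain \<tau> \<beta> where eq: "k = (\<tau>, \<beta>)" by (cases k)
    have nz: "lookup r (\<tau>, \<beta>) \<noteq> 0" using k unfolding eq in_keys_iff .
    have idx: "(\<tau>, \<beta>) \<in> ext_sym_indices n a b w"
      using r k unfolding eq L_module_def ext_sym_restricted_eq by blast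
    have "multidegree (\<tau>, \<beta>) i \<noteq> w i"
    proof
      assume deg: "multidegree (\<tau>, \<beta>) i = w i"
      show False
      proof (cases "i \<in> \<tau>")
        case False
        then show ?thesis using deg zero nz by (auto simp: multidegree_def)
      next
        case True
        have "lookup r (\<tau>, \<beta>) = 0"
        proof (rule L_module_coordinate_zero[OF r True])
          fix s \<beta>' assume "s \<notin> \<tau>" and \<beta>': "\<beta>' = \<beta> + single i 1 - single s 1"
          then have "s \<noteq> i" using True by blast
          then have "lookup \<beta>' i = w i"
            using deg True unfolding \<beta>' by (simp add: multidegree_def lookup_add lookup_minus lookup_single)
          then show "lookup r (insert s (\<tau> - {i}), \<beta>') = 0" by (rule zero)
        qed
        then show False using nz by blast
      qed
    qed
    moreover have "multidegree (\<tau>, \<beta>) i \<le> w i" using idx i(1) unfolding ext_sym_indices_iff by blast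
    ultimately show ?thesis using idx unfolding eq ext_sym_indices_iff by auto
  qed
  then show ?thesis using r unfolding L_module_def ext_sym_restricted_eq by blast
qed

lemma module_hom_Kos: "module_hom fscale fscale (Kos_tensor_1 x)"
  unfolding Kos_eq_contract by (rule module_hom_contract)

lemma Kos_Kos: "Kos_tensor_1 x (Kos_tensor_1 x p) = 0"
  unfolding Kos_eq_contract by (rule contract_contract_same)

lemma L_module_exact:
  assumes x: "subset_regular x {1..n}" and "p \<in> L_module n a (Suc b) w"
    and "if a = 0 then sym_eval n x p = 0 else Kos_tensor_1 x p = 0"
  shows "p \<in> Kos_tensor_1 x ` L_module n (Suc a) (Suc b) w"
  using assms(2,3)
proof (induction "\<Sum>i=1..n. w i" arbitrary: w p rule: less_induct)
  case less
  note p = less.prems(1) and cycle = less.prems(2)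
  show ?case
  proof (cases "\<exists>i\<in>{1..n}. w i > 0")
    case False
    \<comment> \<open>With \<open>w = 0\<close> on \<open>{1..n}\<close> the positive symmetric
      degree \<open>Suc b\<close> leaves no index at all.\<close>
    have "k \<notin> ext_sym_indices n a (Suc b) w" for k
    proof
      assume k: "k \<in> ext_sym_indices n a (Suc b) w"
      obtain \<tau> \<beta> where eq: "k = (\<tau>, \<beta>)" by (cases k)
      have "multidegree (\<tau>, \<beta>) i \<le> w i" if "i \<in> {1..n}" for i
        using k that unfolding eq ext_sym_indices_iff by blast
      then have "lookup \<beta> i = 0" if "i \<in> {1..n}" for i
        using False that by (fastforce simp: multidegree_def)
      then have "(\<Sum>i=1..n. lookup \<beta> i) = 0" by (intro sum.neutral) blast
      then show False using k unfolding eq ext_sym_indices_iff by linarith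
    qed
    then have "keys p = {}" using p unfolding L_module_def ext_sym_restricted_eq by blast
    then have "p = Kos_tensor_1 x 0" by (simp add: module_hom.zero[OF module_hom_Kos])
    then show ?thesis using free.subspace_0[OF L_module_subspace] by (rule image_eqI)
  next
    case True
    then obtain i where i: "i \<in> {1..n}" "w i > 0" by blast
    define S where "S = slack n w"
    have "\<forall>\<beta>. \<exists>g. \<forall>\<tau>\<subseteq>S \<beta>. card \<tau> = a \<longrightarrow> lookup p (\<tau>, \<beta>) = koszul x (S \<beta>) g \<tau>"
      unfolding S_def using coordinate_koszul_boundary[OF x p cycle] by blast
    then obtain G where G: "\<And>\<beta> \<tau>. \<tau> \<subseteq> S \<beta> \<Longrightarrow> card \<tau> = a \<Longrightarrow> lookup p (\<tau>, \<beta>) = koszul x (S \<beta>) (G \<beta>) \<tau>"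
      by metis
    \<comment> \<open>The Koszul primitives \<open>G \<beta>\<close> for the various \<beta> are
      chosen independently; one element of the kernel of \<kappa> realises all those with
      \<open>lookup \<beta> i = w i\<close>.\<close>
    obtain q where q: "q \<in> L_module n (Suc a) (Suc b) w"
      and qG: "\<And>\<tau> \<beta>. (\<tau>, \<beta>) \<in> ext_sym_indices n (Suc a) (Suc b) w \<Longrightarrow> lookup \<beta> i = w i \<Longrightarrow> lookup q (\<tau>, \<beta>) = G \<beta> \<tau>"
      using L_module_lift[of i n w "Suc a" b G, OF i] by blast
    have q': "q \<in> ext_sym_restricted n (Suc a) (Suc b) w" using q by (simp add: L_module_def)
    define r where "r = p - Kos_tensor_1 x q"
    have r: "r \<in> L_module n a (Suc b) w"
      unfolding r_def by (intro free.subspace_diff[OF L_module_subspace] p Kos_L_module[OF q])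
    have zero: "lookup r (\<tau>, \<beta>) = 0" if \<beta>: "lookup \<beta> i = w i" for \<tau> \<beta>
    proof (cases "(\<tau>, \<beta>) \<in> ext_sym_indices n a (Suc b) w")
      case False
      then show ?thesis using r lookup_ext_sym_restricted unfolding L_module_def by blast
    next
      case idx: True
      have \<tau>: "\<tau> \<subseteq> S \<beta>" "card \<tau> = a"
        using ext_sym_indices_less[OF idx] idx unfolding S_def ext_sym_indices_iff by auto
      \<comment> \<open>\<open>Kos_tensor_1\<close> leaves \<beta> alone, so at this \<beta> it is
        the Koszul differential on the slack variables applied to \<open>G \<beta>\<close>.\<close>
      have "lookup (Kos_tensor_1 x q) (\<tau>, \<beta>) = koszul x (S \<beta>) (G \<beta>) \<tau>"
        unfolding lookup_Kos[OF q'] koszul_def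
      proof (rule sum.mono_neutral_cong_right)
        show "\<forall>s\<in>({1..n} - \<tau>) - (S \<beta> - \<tau>). position_sign \<tau> s * x s * lookup q (insert s \<tau>, \<beta>) = 0"
        proof
          fix s assume "s \<in> ({1..n} - \<tau>) - (S \<beta> - \<tau>)"
          then have "(insert s \<tau>, \<beta>) \<notin> ext_sym_indices n (Suc a) (Suc b) w"
            using ext_sym_indices_less(2)[of "insert s \<tau>" \<beta> n "Suc a" "Suc b" w s] by (auto simp: S_def)
          then have "lookup q (insert s \<tau>, \<beta>) = 0" by (rule lookup_ext_sym_restricted[OF q'])
          then show "position_sign \<tau> s * x s * lookup q (insert s \<tau>, \<beta>) = 0" by (simp only: mult_zero_right)
        qed
        fix s assume "s \<in> S \<beta> - \<tau>"
        then have "(insert s \<tau>, \<beta>) \<in> ext_sym_indices n (Suc a) (Suc b) w"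
          using ext_sym_indices_insert[OF idx, of s] by (auto simp: S_def)
        then show "position_sign \<tau> s * x s * lookup q (insert s \<tau>, \<beta>) = position_sign \<tau> s * x s * G \<beta> (insert s \<tau>)"
          using qG \<beta> by simp
      qed (auto simp: S_def)
      then show ?thesis using G[OF \<tau>] by (simp add: r_def lookup_minus)
    qed
    let ?w = "w(i := w i - 1)"
    \<comment> \<open>The correction \<open>r\<close> is still a cycle and now lives under the
      smaller bound, where the induction hypothesis provides a preimage.\<close>
    have "r \<in> L_module n a (Suc b) ?w" using r i zero by (rule L_module_decrease)
    moreover have "if a = 0 then sym_eval n x r = 0 else Kos_tensor_1 x r = 0"
      using cycle unfolding r_def module_hom.diff[OF module_hom_sym_eval] module_hom.diff[OF module_hom_Kos]
        sym_eval_Kos_L_module[OF q] Kos_Kos by simp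
    moreover have "(\<Sum>i=1..n. ?w i) < (\<Sum>i=1..n. w i)"
      using i by (intro sum_strict_mono_ex1) auto
    ultimately have "r \<in> Kos_tensor_1 x ` L_module n (Suc a) (Suc b) ?w" by (intro less.hyps)
    then obtain q2 where q2: "q2 \<in> L_module n (Suc a) (Suc b) ?w" "r = Kos_tensor_1 x q2" by blast
    have "q2 \<in> L_module n (Suc a) (Suc b) w"
      using q2(1) by (rule subsetD[OF L_module_mono, rotated]) simp
    then have "q + q2 \<in> L_module n (Suc a) (Suc b) w" using q by (intro free.subspace_add[OF L_module_subspace])
    moreover have "p = Kos_tensor_1 x (q + q2)"
      unfolding module_hom.add[OF module_hom_Kos] q2(2)[symmetric] r_def by simp
    ultimately show ?thesis by blast
  qed
qed

text \<open>In exterior degree \<open>n\<close> the only exterior part is \<open>{1..n}\<close>, so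
  the \<kappa>-relation at any vertex has a single term. This is why the complex stops at
  homological degree \<open>n\<close>.\<close>

lemma L_module_top:
  assumes "n \<ge> 1" "a \<ge> n"
  shows "L_module n a d w = {0}"
proof -
  have "p = 0" if p: "p \<in> L_module n a d w" for p :: "ext_sym_index \<Rightarrow>\<^sub>0 'a"
  proof (rule poly_mapping_eqI)
    fix k :: ext_sym_index
    obtain \<tau> \<beta> where eq: "k = (\<tau>, \<beta>)" by (cases k)
    have "lookup p (\<tau>, \<beta>) = 0"
    proof (cases "(\<tau>, \<beta>) \<in> ext_sym_indices n a d w")
      case False
      then show ?thesis using p lookup_ext_sym_restricted unfolding L_module_def by blast
    next
      case True
      then have "\<tau> \<subseteq> {1..n}" "card \<tau> \<ge> n" using assms(2) unfolding ext_sym_indices_iff by auto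
      then have \<tau>: "\<tau> = {1..n}" by (intro card_seteq) auto
      show ?thesis
        by (rule L_module_coordinate_zero[OF p, of 1]) (use \<tau> assms(1) in auto)
    qed
    then show "lookup p k = lookup 0 k" by (simp add: eq)
  qed
  then show ?thesis using free.subspace_0[OF L_module_subspace, of n a d w] by auto
qed

section \<open>Assembly of the resolution\<close>

lemma L_complex_eq:
  assumes "n \<ge> 1" "i \<ge> 1"
  shows "L_complex n d w i = L_module n (i - 1) d w"
  using assms by (cases "i \<le> n") (simp_all add: L_complex_def L_module_top)

lemma sym_eval_image:
  "sym_eval n x ` L_module n 0 d w = restricted_power n x d w"
proof -
  let ?I = "ext_sym_indices n 0 d w" and ?e = "\<lambda>k. single k 1 :: ext_sym_index \<Rightarrow>\<^sub>0 'a"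
  have "L_module n 0 d w = (ext_sym_restricted n 0 d w :: (ext_sym_index \<Rightarrow>\<^sub>0 'a) set)"
    unfolding L_module_def using kappa_zero_exterior_degree by blast
  then have "sym_eval n x ` L_module n 0 d w = ideal_gen (sym_eval n x ` ?e ` ?I)"
    unfolding ext_sym_restricted_def by (simp only: module_hom.span_image[OF module_hom_sym_eval])
  also have "sym_eval n x ` ?e ` ?I =
    {\<Prod>i=1..n. x i ^ \<alpha> i | \<alpha> :: nat \<Rightarrow> nat. (\<forall>i\<in>{1..n}. \<alpha> i \<le> w i) \<and> (\<Sum>i=1..n. \<alpha> i) = d}"
    (is "_ = ?M")
  proof
    show "sym_eval n x ` ?e ` ?I \<subseteq> ?M"
    proof clarify
      fix \<sigma> \<beta> assume idx: "(\<sigma>, \<beta>) \<in> ?I"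
      have "lookup \<beta> i \<le> w i" if "i \<in> {1..n}" for i
      proof -
        have "multidegree (\<sigma>, \<beta>) i \<le> w i" using idx that unfolding ext_sym_indices_iff by blast
        then show ?thesis by (simp add: multidegree_def)
      qed
      moreover have "(\<Sum>i=1..n. lookup \<beta> i) = d" using idx unfolding ext_sym_indices_iff by blast
      ultimately show "\<exists>\<alpha>. sym_eval n x (?e (\<sigma>, \<beta>)) = (\<Prod>i=1..n. x i ^ \<alpha> i) \<and>
          (\<forall>i\<in>{1..n}. \<alpha> i \<le> w i) \<and> (\<Sum>i=1..n. \<alpha> i) = d"
        unfolding sym_eval_single mult_1_left by blast
    qed
    show "?M \<subseteq> sym_eval n x ` ?e ` ?I"
    proof
      fix y assume "y \<in> ?M"
      then obtain \<alpha> :: "nat \<Rightarrow> nat" where y: "y = (\<Prod>i=1..n. x i ^ \<alpha> i)"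
        and le: "\<forall>i\<in>{1..n}. \<alpha> i \<le> w i" and d: "(\<Sum>i=1..n. \<alpha> i) = d" by blast
      \<comment> \<open>The exponent \<alpha> is an arbitrary function; outside
        \<open>{1..n}\<close> it is replaced by 0 to obtain finite support.\<close>
      define \<beta> where "\<beta> = Abs_poly_mapping (\<lambda>i. if i \<in> {1..n} then \<alpha> i else 0)"
      have "finite {i. (if i \<in> {1..n} then \<alpha> i else 0) \<noteq> 0}"
        by (rule finite_subset[of _ "{1..n}"]) (auto split: if_splits)
      then have \<beta>: "lookup \<beta> = (\<lambda>i. if i \<in> {1..n} then \<alpha> i else 0)"
        unfolding \<beta>_def by (rule lookup_Abs_poly_mapping)
      have "keys \<beta> \<subseteq> {1..n}" unfolding keys.rep_eq \<beta> by (auto split: if_splits)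
      moreover have "(\<Sum>i=1..n. lookup \<beta> i) = d" unfolding \<beta> d[symmetric] by (intro sum.cong) auto
      moreover have "multidegree ({}, \<beta>) i \<le> w i" if "i \<in> {1..n}" for i
        using le that by (simp add: multidegree_def \<beta>)
      ultimately have "({}, \<beta>) \<in> ?I" unfolding ext_sym_indices_iff by simp
      moreover have "(\<Prod>i=1..n. x i ^ \<alpha> i) = sym_eval n x (?e ({}, \<beta>))"
        unfolding sym_eval_single mult_1_left \<beta> by (intro prod.cong) auto
      ultimately show "y \<in> sym_eval n x ` ?e ` ?I" unfolding y by blast
    qed
  qed
  finally show ?thesis unfolding restricted_power_def .
qed

text \<open>The ring enters only through \<open>subset_regular\<close> and an ideal \<open>J\<close>
  containing the \<open>x i\<close>, so the local and the graded case are handled together.\<close>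

theorem L_complex_minimal_free_resolution:
  assumes n: "n \<ge> 1" and x: "subset_regular x {1..n}" and J: "is_ideal J"
    and xJ: "\<And>i. i \<in> {1..n} \<Longrightarrow> x i \<in> J" and "d \<ge> 1"
  shows "minimal_free_resolution_of_quotient fscale (L_complex n d w) (\<lambda>i. Kos_tensor_1 x)
    (sym_eval n x) (restricted_power n x d w) J"
proof -
  obtain b where d: "d = Suc b" using \<open>d \<ge> 1\<close> by (cases d) auto
  let ?C = "L_complex n d w :: nat \<Rightarrow> (ext_sym_index \<Rightarrow>\<^sub>0 'a) set"
  have C: "?C i = L_module n (i - 1) (Suc b) w" if "i \<ge> 1" for i
    unfolding d by (rule L_complex_eq[OF n that])
  have C1: "?C 1 = L_module n 0 (Suc b) w" and C2: "?C 2 = L_module n (Suc 0) (Suc b) w"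
    using C[of 1] C[of 2] by simp_all
  \<comment> \<open>Homological degree \<open>i \<ge> 2\<close> carries exterior degree
    \<open>i - 1 = Suc a\<close>; its neighbours carry \<open>a\<close> and
    \<open>Suc (Suc a)\<close>.\<close>
  have Ci: "\<exists>a. ?C i = L_module n (Suc a) (Suc b) w \<and> ?C (i - 1) = L_module n a (Suc b) w \<and>
      ?C (Suc i) = L_module n (Suc (Suc a)) (Suc b) w" if i: "i \<ge> 2" for i
  proof -
    obtain a where "i = Suc (Suc a)" using i by (metis add_2_eq_Suc le_Suc_ex)
    then show ?thesis using C[of i] C[of "i - 1"] C[of "Suc i"] by (intro exI[of _ a]) simp
  qed
  have res: "free_resolution_of_quotient fscale ?C (\<lambda>i. Kos_tensor_1 x) (sym_eval n x) (restricted_power n x d w)"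
    unfolding free_resolution_of_quotient_def
  proof (intro conjI allI impI)
    show "\<exists>B. basis_of fscale B (?C i)" if "i \<ge> 1" for i
      unfolding C[OF that] using basis_of_L_module by blast
    show "module_hom fscale (*) (sym_eval n x)" by (rule module_hom_sym_eval)
    show "module_hom fscale fscale (Kos_tensor_1 x)" by (rule module_hom_Kos)
    show "Kos_tensor_1 x ` ?C i \<subseteq> ?C (i - 1)" if i: "2 \<le> i" for i
    proof -
      from Ci[OF i] obtain a where a: "?C i = L_module n (Suc a) (Suc b) w" "?C (i - 1) = L_module n a (Suc b) w"
        by blast
      show ?thesis unfolding a using Kos_L_module by blast
    qed
    show "sym_eval n x ` ?C 1 = restricted_power n x d w" unfolding C1 unfolding d by (rule sym_eval_image)
    show "{p \<in> ?C 1. sym_eval n x p = 0} = Kos_tensor_1 x ` ?C 2"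
      unfolding C1 C2 using L_module_exact[OF x, of _ 0 b w] Kos_L_module sym_eval_Kos_L_module by fastforce
    show "{p \<in> ?C i. Kos_tensor_1 x p = 0} = Kos_tensor_1 x ` ?C (Suc i)" if i: "2 \<le> i" for i
    proof -
      from Ci[OF i] obtain a where a: "?C i = L_module n (Suc a) (Suc b) w"
        "?C (Suc i) = L_module n (Suc (Suc a)) (Suc b) w" by blast
      show ?thesis
        unfolding a using L_module_exact[OF x, of _ "Suc a" b w] Kos_L_module Kos_Kos by fastforce
    qed
  qed
  have "minimal_complex fscale ?C (\<lambda>i. Kos_tensor_1 x) (sym_eval n x) J"
    unfolding minimal_complex_def
  proof (intro conjI allI impI ballI)
    fix A a assume A: "basis_of fscale A (?C 1)" and a: "a \<in> A"
    have "a \<in> ?C 1" using A free.span_base[OF a] by (simp add: basis_of_def)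
    then have "sym_eval n x a \<in> restricted_power n x d w" unfolding C1 sym_eval_image[symmetric] unfolding d by blast
    moreover have "restricted_power n x d w \<subseteq> J"
      unfolding restricted_power_def
    proof (rule ring.span_minimal[OF _ J], rule subsetI)
      fix y assume "y \<in> {\<Prod>i=1..n. x i ^ \<alpha> i | \<alpha> :: nat \<Rightarrow> nat.
        (\<forall>i\<in>{1..n}. \<alpha> i \<le> w i) \<and> (\<Sum>i=1..n. \<alpha> i) = d}"
      then obtain \<alpha> :: "nat \<Rightarrow> nat" where y: "y = (\<Prod>i=1..n. x i ^ \<alpha> i)"
        and "(\<Sum>i=1..n. \<alpha> i) = d" by blast
      \<comment> \<open>A monomial of degree \<open>d \<ge> 1\<close> has some factor
        \<open>x i\<close>, which lies in \<open>J\<close>.\<close>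
      then have "(\<Sum>i=1..n. \<alpha> i) \<noteq> 0" using \<open>d \<ge> 1\<close> by linarith
      then obtain i where i: "i \<in> {1..n}" "\<alpha> i \<noteq> 0" by (meson sum.neutral)
      have "x i dvd x i ^ \<alpha> i" using i(2) by (simp add: dvd_power)
      also have "\<dots> dvd (\<Prod>i=1..n. x i ^ \<alpha> i)"
        by (rule dvd_prodI[where f = "\<lambda>i. x i ^ \<alpha> i"]) (use i(1) in auto)
      finally obtain c where "(\<Prod>i=1..n. x i ^ \<alpha> i) = c * x i" by (metis dvdE mult.commute)
      then show "y \<in> J" unfolding y using ring.subspace_scale[OF J xJ[OF i(1)]] by simp
    qed
    ultimately show "sym_eval n x a \<in> J" by blast
  next
    fix i A B a c
    assume i: "2 \<le> i" and A: "basis_of fscale A (?C i)" and B: "basis_of fscale B (?C (i - 1))" and a: "a \<in> A"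
    from Ci[OF i] obtain m where m: "?C i = L_module n (Suc m) (Suc b) w" "?C (i - 1) = L_module n m (Suc b) w"
      by blast
    have aL: "a \<in> L_module n (Suc m) (Suc b) w"
      using A free.span_base[OF a] unfolding m by (simp add: basis_of_def)
    then have "a \<in> ext_sym_restricted n (Suc m) (Suc b) w" by (simp add: L_module_def)
    then show "free.representation B (Kos_tensor_1 x a) c \<in> J"
      by (intro representation_in_ideal[OF J B[unfolded m] Kos_L_module[OF aL]]
          lookup_Kos_in_ideal[OF J xJ])
  qed
  then show ?thesis using res by (simp add: minimal_free_resolution_of_quotient_def)
qed

text \<open>A regular sequence generates a proper ideal, and \<open>J\<close> contains every proper
  ideal.\<close>

lemma regular_sequence_in_local:
  assumes "local_with_maximal_ideal J" "regular_sequence xs"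
  shows "set xs \<subseteq> J"
  using proper_ideal_le_local[OF assms(1), of "ideal_gen (set xs)"] assms(2) ring.span_superset[of "set xs"]
  by (auto simp: regular_sequence_def)

theorem theorem3p10:
  fixes scaleF :: "'r::comm_ring_1 \<Rightarrow> 'f::ab_group_add \<Rightarrow> 'f"
    and f :: "nat \<Rightarrow> 'f" and \<psi> :: "'f \<Rightarrow> 'r"
    and n d :: nat and w :: "nat \<Rightarrow> nat" and J :: "'r set"
  assumes "n \<ge> 1"
    and "module scaleF"
    and "inj_on f {1..n}" and "basis_of scaleF (f ` {1..n}) UNIV"
    and "module_hom scaleF (*) \<psi>"
    and "grade (range \<psi>) = enat n"
    and "regular_sequence (map (\<lambda>i. \<psi> (f i)) [1..<Suc n])"
    and "(noetherian TYPE('r) \<and> local_with_maximal_ideal J) \<or>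
         (\<exists>G. int_grading G \<and> (\<forall>i\<in>{1..n}. \<exists>k>0. \<psi> (f i) \<in> G k) \<and>
              (bounded_below G \<or> permutably_regular (map (\<lambda>i. \<psi> (f i)) [1..<Suc n])) \<and>
              J = positive_ideal G)"
    and "d \<ge> 1"
  shows "minimal_free_resolution_of_quotient fscale
           (L_complex n d w) (\<lambda>i. Kos_tensor_1 (\<lambda>i. \<psi> (f i))) (sym_eval n (\<lambda>i. \<psi> (f i)))
           (restricted_power n (\<lambda>i. \<psi> (f i)) d w) J"
proof -
  define x where "x = (\<lambda>i. \<psi> (f i))"
  define xs where "xs = map x [1..<Suc n]"
  have xs: "regular_sequence xs" using assms(7) by (simp only: xs_def x_def)
  have set: "set xs = x ` {1..n}" by (auto simp: xs_def simp del: upt_Suc)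
  \<comment> \<open>Both kinds of rings are reduced to these facts. In the local case the
    \<open>x i\<close> lie in \<open>J\<close> by properness, in the graded case by positivity of
    their degrees.\<close>
  have "permutably_regular xs \<and> is_ideal J \<and> x ` {1..n} \<subseteq> J"
    using assms(8)
  proof
    assume "noetherian TYPE('r) \<and> local_with_maximal_ideal J"
    then have noeth: "noetherian TYPE('r)" and J: "local_with_maximal_ideal J" by auto
    have "set xs \<subseteq> J" by (rule regular_sequence_in_local[OF J xs])
    moreover from this have "permutably_regular xs"
      by (intro swappable_imp_permutably_regular[OF noetherian_local_swappable[OF noeth J] xs])
    moreover have "is_ideal J" using J by (simp add: local_with_maximal_ideal_def maximal_ideal_def)
    ultimately show ?thesis unfolding set by blast
  next
    assume "\<exists>G. int_grading G \<and> (\<forall>i\<in>{1..n}. \<exists>k>0. \<psi> (f i) \<in> G k) \<and>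
      (bounded_below G \<or> permutably_regular (map (\<lambda>i. \<psi> (f i)) [1..<Suc n])) \<and> J = positive_ideal G"
    then obtain G where G: "int_grading G" "\<forall>i\<in>{1..n}. \<exists>k>0. \<psi> (f i) \<in> G k"
      and reg: "bounded_below G \<or> permutably_regular (map (\<lambda>i. \<psi> (f i)) [1..<Suc n])"
      and J: "J = positive_ideal G" by blast
    interpret graded_ring G by unfold_locales fact
    have pos: "\<exists>k>0. y \<in> G k" if "y \<in> set xs" for y
      using that G(2) unfolding set x_def by blast
    have "permutably_regular xs"
    proof (cases "bounded_below G")
      case True
      then show ?thesis
        using swappable_imp_permutably_regular[OF bounded_below_swappable xs] pos by blast
    next
      case False
      then show ?thesis using reg by (simp only: xs_def x_def simp_thms)
    qed
    moreover have "is_ideal J" unfolding J positive_ideal_def by (rule ring.subspace_span)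
    moreover have "x ` {1..n} \<subseteq> J"
    proof
      fix y assume "y \<in> x ` {1..n}"
      then have "y \<in> (\<Union>k\<in>{0<..}. G k)" using pos unfolding set by blast
      then show "y \<in> J" unfolding J positive_ideal_def by (rule ring.span_base)
    qed
    ultimately show ?thesis by blast
  qed
  then show ?thesis
    using L_complex_minimal_free_resolution[OF assms(1) permutably_regular_imp_subset_regular, of x J d w] assms(9)
    unfolding xs_def x_def by blast
qed

end
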